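(* If $N$ is a knot manifold and $\mathsf{X}$ is a norm curve component of $\mathsf{X}(N)$, then $\mathrm{Rk}_{\mathsf{X}}^{\mathbb{C}}(\alpha)\geq 2$ for every slope $\alpha$.
   Context: A knot manifold is a connected, compact, irreducible, orientable 3-manifold whose boundary is an incompressible torus. $\mathsf{X}(N)$ is the affine algebraic set of characters $\chi_\rho=\mathrm{Tr}\circ\rho$ of representations $\rho\colon\pi_1(N)\to\mathrm{SL}_2(\mathbb{C})$. For an algebraic subset $\mathsf{X}\subseteq\mathsf{X}(N)$ and $\gamma\in\pi_1(N)$, $I_\gamma\in\mathbb{C}[\mathsf{X}]$ is $I_\gamma(\chi)=\chi(\gamma)$. An (irreducible) algebraic curve component $\mathsf{X}$ of $\mathsf{X}(N)$ is a norm curve component if $I_\gamma\colon\mathsf{X}\to\mathbb{C}$ is non-constant for every non-trivial peripheral element $\gamma\in\pi_1(N)$. A slope $\alpha$ is the unoriented isotopy class of an essential simple closed curve in $\partial N$, and $I_\alpha:=I_\gamma$ for any peripheral element $\gamma$ representing $\alpha$. $\mathrm{Rk}_{\mathsf{X}}^{\mathbb{C}}(\alpha)\in\mathbb{Z}^+\cup\{\infty\}$ is the rank of $\mathbb{C}[\mathsf{X}]$ as a module over its subring $\mathbb{C}[I_\alpha]$, where rank means the minimal number of elements in a generating set ($\infty$ if not finitely generated). *)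

theory Defs
  imports "HOL-Analysis.Analysis" "HOL-Homology.Homology" "HOL-Algebra.Generated_Rings"
    "HOL-Library.Extended_Nat"
begin

section \<open>Knot manifolds\<close>

text \<open>
  Manifolds are subsets of a topological space, with the subspace topology. All notions are
  topological; embedded spheres are required to be locally flat.
\<close>

definition half_space :: "(real^3) set" where
  "half_space = {y. 0 \<le> y $ 3}"

definition three_manifold :: "'a::topological_space set \<Rightarrow> bool" where
  "three_manifold M \<longleftrightarrow>
     Hausdorff_space (top_of_set M) \<and> second_countable (top_of_set M) \<and>
     (\<forall>x\<in>M. \<exists>U V. openin (top_of_set M) U \<and> x \<in> U \<and>
        openin (top_of_set half_space) V \<and> U homeomorphic V)"

definition manifold_boundary :: "'a::topological_space set \<Rightarrow> 'a set" where
  "manifold_boundary M =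
     {x \<in> M. \<exists>U V f g. openin (top_of_set M) U \<and> x \<in> U \<and>
        openin (top_of_set half_space) V \<and> homeomorphism U V f g \<and> f x $ 3 = 0}"

definition manifold_interior :: "'a::topological_space set \<Rightarrow> 'a set" where
  "manifold_interior M = M - manifold_boundary M"

text \<open>
  A local orientation of a 3-manifold \<open>W\<close> without boundary at \<open>x\<close> is a generator of
  \<open>H\<^sub>3(W, W - {x})\<close>. An orientation is a locally consistent choice of local orientations.
  A manifold with boundary is orientable if its interior is.
\<close>

definition orientable_boundaryless :: "'a::topological_space set \<Rightarrow> bool" where
  "orientable_boundaryless W \<longleftrightarrow>
     (\<exists>\<mu>. (\<forall>x\<in>W.
             \<mu> x \<in> carrier (relative_homology_group 3 (top_of_set W) (W - {x})) \<and>
             generate (relative_homology_group 3 (top_of_set W) (W - {x})) {\<mu> x} =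
               carrier (relative_homology_group 3 (top_of_set W) (W - {x}))) \<and>
          (\<forall>x\<in>W. \<exists>U. openin (top_of_set W) U \<and> x \<in> U \<and>
             (\<exists>\<nu> \<in> carrier (relative_homology_group 3 (top_of_set W) (W - U)).
                \<forall>y\<in>U. hom_induced 3 (top_of_set W) (W - U) (top_of_set W) (W - {y}) id \<nu> = \<mu> y)))"

definition orientable_three_manifold :: "'a::topological_space set \<Rightarrow> bool" where
  "orientable_three_manifold M \<longleftrightarrow> orientable_boundaryless (manifold_interior M)"

definition locally_flat_in :: "'a::topological_space set \<Rightarrow> 'a set \<Rightarrow> bool" where
  "locally_flat_in M S \<longleftrightarrow> S \<subseteq> M \<and>
     (\<forall>x\<in>S. \<exists>U f g. openin (top_of_set M) U \<and> x \<in> U \<and>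
        homeomorphism U (UNIV :: (real^3) set) f g \<and> f ` (U \<inter> S) = {y. y $ 3 = 0})"

definition irreducible_three_manifold :: "'a::topological_space set \<Rightarrow> bool" where
  "irreducible_three_manifold M \<longleftrightarrow>
     (\<forall>S. locally_flat_in M S \<and> S homeomorphic (sphere 0 1 :: (real^3) set) \<longrightarrow>
        (\<exists>B f g. B \<subseteq> M \<and> homeomorphism (cball (0::real^3) 1) B f g \<and> f ` sphere 0 1 = S))"

text \<open>Incompressibility of a surface (other than a sphere): injectivity on fundamental groups.\<close>

definition incompressible_in :: "'a::topological_space set \<Rightarrow> 'a set \<Rightarrow> bool" where
  "incompressible_in M F \<longleftrightarrow>
     (\<forall>p q. path p \<and> path_image p \<subseteq> F \<and> path q \<and> path_image q \<subseteq> F \<and>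
        pathfinish p = pathstart p \<and> pathstart q = pathstart p \<and> pathfinish q = pathstart p \<and>
        homotopic_paths M p q \<longrightarrow> homotopic_paths F p q)"

definition knot_manifold :: "'a::topological_space set \<Rightarrow> bool" where
  "knot_manifold N \<longleftrightarrow>
     three_manifold N \<and> connected N \<and> compact N \<and>
     irreducible_three_manifold N \<and> orientable_three_manifold N \<and>
     manifold_boundary N homeomorphic
       ((sphere 0 1 :: complex set) \<times> (sphere 0 1 :: complex set)) \<and>
     incompressible_in N (manifold_boundary N)"

section \<open>The fundamental group, peripheral elements, slopes\<close>

definition fundamental_group ::
    "'a::topological_space set \<Rightarrow> 'a \<Rightarrow> (real \<Rightarrow> 'a) set monoid" where
  "fundamental_group S x =
     \<lparr>carrier = {p. path p \<and> path_image p \<subseteq> S \<and> pathstart p = x \<and> pathfinish p = x}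
                 // {(p, q). homotopic_paths S p q},
      mult = (\<lambda>A B. {r. \<exists>p\<in>A. \<exists>q\<in>B. homotopic_paths S (p +++ q) r}),
      one = {r. homotopic_paths S (\<lambda>_. x) r}\<rparr>"

text \<open>
  The base point need not lie on the boundary: an element is peripheral if it is conjugate into
  the image of the fundamental group of the boundary, that is, freely homotopic into the boundary.
\<close>

definition peripheral :: "'a::topological_space set \<Rightarrow> 'a \<Rightarrow> (real \<Rightarrow> 'a) set \<Rightarrow> bool" where
  "peripheral N x \<gamma> \<longleftrightarrow> \<gamma> \<in> carrier (fundamental_group N x) \<and>
     (\<exists>p\<in>\<gamma>. \<exists>l. path_image l \<subseteq> manifold_boundary N \<and> homotopic_loops N p l)"

definition essential_curves :: "'a::topological_space set \<Rightarrow> (real \<Rightarrow> 'a) set" where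
  "essential_curves F =
     {c. simple_path c \<and> pathfinish c = pathstart c \<and> path_image c \<subseteq> F \<and>
         (\<nexists>a. homotopic_loops F c (\<lambda>_. a))}"

definition isotopic_curves ::
    "'a::topological_space set \<Rightarrow> (real \<Rightarrow> 'a) \<Rightarrow> (real \<Rightarrow> 'a) \<Rightarrow> bool" where
  "isotopic_curves F c d \<longleftrightarrow>
     homotopic_with_canon (\<lambda>r. simple_path r \<and> pathfinish r = pathstart r) {0..1} F c d"

text \<open>
  A slope is the set of all parametrisations, in both directions, of the curves in an unoriented
  isotopy class.
\<close>

definition slopes :: "'a::topological_space set \<Rightarrow> (real \<Rightarrow> 'a) set set" where
  "slopes N =
     (let F = manifold_boundary N in
      essential_curves F //
        {(c, d). c \<in> essential_curves F \<and> d \<in> essential_curves F \<and>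
           (isotopic_curves F c d \<or> isotopic_curves F (reversepath c) d)})"

definition represents_slope ::
    "'a::topological_space set \<Rightarrow> 'a \<Rightarrow> (real \<Rightarrow> 'a) set \<Rightarrow> (real \<Rightarrow> 'a) set \<Rightarrow> bool" where
  "represents_slope N x \<gamma> \<alpha> \<longleftrightarrow>
     peripheral N x \<gamma> \<and> (\<exists>p\<in>\<gamma>. \<exists>c\<in>\<alpha>. homotopic_loops N p c)"

section \<open>Character varieties\<close>

definition SL2C :: "(complex^2^2) monoid" where
  "SL2C = \<lparr>carrier = {A. det A = 1}, mult = (**), one = mat 1\<rparr>"

definition characters :: "'g monoid \<Rightarrow> ('g \<Rightarrow> complex) set" where
  "characters G = {(\<lambda>\<gamma>\<in>carrier G. trace (\<rho> \<gamma>)) | \<rho>. \<rho> \<in> hom G SL2C}"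

definition function_ring :: "'x set \<Rightarrow> ('x \<Rightarrow> complex) ring" where
  "function_ring X =
     \<lparr>carrier = extensional X,
      mult = (\<lambda>f g. \<lambda>x\<in>X. f x * g x), one = (\<lambda>x\<in>X. 1),
      zero = (\<lambda>x\<in>X. 0), add = (\<lambda>f g. \<lambda>x\<in>X. f x + g x)\<rparr>"

definition constant_functions :: "'x set \<Rightarrow> ('x \<Rightarrow> complex) set" where
  "constant_functions X = range (\<lambda>c. \<lambda>x\<in>X. c)"

definition trace_function :: "('g \<Rightarrow> complex) set \<Rightarrow> 'g \<Rightarrow> ('g \<Rightarrow> complex) \<Rightarrow> complex" where
  "trace_function X \<gamma> = (\<lambda>\<xi>\<in>X. \<xi> \<gamma>)"

text \<open>
  The set of characters is viewed in affine space by means of the coordinates \<open>\<xi> \<mapsto> \<xi> \<gamma>\<close>, for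
  all \<open>\<gamma>\<close> in \<open>G\<close>. If \<open>G\<close> is finitely generated, finitely many of these coordinates embed the set of
  characters in affine space and the others are polynomials in them, so this is the usual affine
  structure. The functions induced on \<open>X\<close> by polynomials are those in the complex algebra
  generated by the trace functions.
\<close>

definition coordinate_ring ::
    "'g monoid \<Rightarrow> ('g \<Rightarrow> complex) set \<Rightarrow> (('g \<Rightarrow> complex) \<Rightarrow> complex) set" where
  "coordinate_ring G X =
     generate_ring (function_ring X) (constant_functions X \<union> trace_function X ` carrier G)"

definition algebraic_subset :: "'g monoid \<Rightarrow> ('g \<Rightarrow> complex) set \<Rightarrow> bool" where
  "algebraic_subset G X \<longleftrightarrow>
     (\<exists>F \<subseteq> coordinate_ring G (characters G). X = {\<xi> \<in> characters G. \<forall>f\<in>F. f \<xi> = 0})"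

definition irreducible_algebraic_subset :: "'g monoid \<Rightarrow> ('g \<Rightarrow> complex) set \<Rightarrow> bool" where
  "irreducible_algebraic_subset G X \<longleftrightarrow> algebraic_subset G X \<and> X \<noteq> {} \<and>
     (\<forall>A B. algebraic_subset G A \<and> algebraic_subset G B \<and> X = A \<union> B \<longrightarrow> X = A \<or> X = B)"

definition algebraic_component :: "'g monoid \<Rightarrow> ('g \<Rightarrow> complex) set \<Rightarrow> bool" where
  "algebraic_component G X \<longleftrightarrow> irreducible_algebraic_subset G X \<and>
     (\<forall>Y. irreducible_algebraic_subset G Y \<and> X \<subseteq> Y \<longrightarrow> Y = X)"

definition algebraic_dim :: "'g monoid \<Rightarrow> ('g \<Rightarrow> complex) set \<Rightarrow> enat" where
  "algebraic_dim G X =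
     Sup {enat n | n. \<exists>Z. (\<forall>i\<le>n. irreducible_algebraic_subset G (Z i) \<and> Z i \<subseteq> X) \<and>
                          (\<forall>i<n. Z i \<subset> Z (Suc i))}"

definition norm_curve_component ::
    "'a::topological_space set \<Rightarrow> 'a \<Rightarrow> ((real \<Rightarrow> 'a) set \<Rightarrow> complex) set \<Rightarrow> bool" where
  "norm_curve_component N x X \<longleftrightarrow>
     algebraic_component (fundamental_group N x) X \<and>
     algebraic_dim (fundamental_group N x) X = 1 \<and>
     (\<forall>\<gamma>. peripheral N x \<gamma> \<and> \<gamma> \<noteq> \<one>\<^bsub>fundamental_group N x\<^esub> \<longrightarrow>
        trace_function X \<gamma> \<notin> constant_functions X)"

section \<open>Rank\<close>

text \<open>
  The minimal number of generators of \<open>M \<subseteq> R\<close> as a module over the subring \<open>K\<close> of \<open>R\<close>. The infimum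
  of the empty set is \<open>\<infinity>\<close>.
\<close>

definition module_rank :: "('r, 'm) ring_scheme \<Rightarrow> 'r set \<Rightarrow> 'r set \<Rightarrow> enat" where
  "module_rank R K M =
     Inf {enat (card S) | S. finite S \<and> S \<subseteq> M \<and>
            M = {(\<Oplus>\<^bsub>R\<^esub>s\<in>S. a s \<otimes>\<^bsub>R\<^esub> s) | a. a \<in> S \<rightarrow> K}}"

text \<open>
  Two elements representing \<open>\<alpha>\<close> are conjugate up to inversion, so they have the same trace
  function and the choice below is immaterial.
\<close>

definition slope_function ::
    "'a::topological_space set \<Rightarrow> 'a \<Rightarrow> ((real \<Rightarrow> 'a) set \<Rightarrow> complex) set \<Rightarrow> (real \<Rightarrow> 'a) set
      \<Rightarrow> ((real \<Rightarrow> 'a) set \<Rightarrow> complex) \<Rightarrow> complex" where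
  "slope_function N x X \<alpha> = trace_function X (SOME \<gamma>. represents_slope N x \<gamma> \<alpha>)"

definition slope_rank ::
    "'a::topological_space set \<Rightarrow> 'a \<Rightarrow> ((real \<Rightarrow> 'a) set \<Rightarrow> complex) set \<Rightarrow> (real \<Rightarrow> 'a) set
      \<Rightarrow> enat" where
  "slope_rank N x X \<alpha> =
     module_rank (function_ring X)
       (generate_ring (function_ring X) (constant_functions X \<union> {slope_function N x X \<alpha>}))
       (coordinate_ring (fundamental_group N x) X)"

end

(*
  If the rank were at most 1, the coordinate ring would be C[I_alpha], so every trace function would
  be a polynomial in I_alpha. For a peripheral element delta commuting with a representative gamma
  of alpha, the trace identities
    I_{delta gamma} + I_{delta gamma^-1} = I_delta I_gamma,
    I_{delta gamma} I_{delta gamma^-1} = I_delta^2 + I_gamma^2 - 4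
  show that one of delta gamma, delta gamma^-1 has a polynomial of smaller degree than delta.
  Starting from a delta outside the subgroup generated by gamma, which exists since the fundamental
  group of the torus is not cyclic and injects, this descends forever: the elements met are all
  non-trivial and peripheral, so their trace functions are non-constant.
*)

theory Submission
  imports Defs "HOL-Computational_Algebra.Polynomial" "HOL-Complex_Analysis.Winding_Numbers"
begin

section \<open>Coordinate rings and traces\<close>

text \<open>Degrees make sense because irreducibility of \<open>X\<close> forces a non-constant
  trace function to take infinitely many values, so a polynomial in \<open>I_\<gamma>\<close> is
  determined by the function it induces on \<open>X\<close>. The main obstacle is the base point.
  The slope function refers to an element picked by \<open>SOME\<close> in the fundamental group at
  \<open>x\<close>, and \<open>x\<close> may lie anywhere in \<open>N\<close>, while commutativity
  and non-cyclicity are facts about the torus \<open>F\<close> with a base point \<open>b\<close> on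
  it. A path \<open>g\<close> from \<open>x\<close> to \<open>b\<close> links the two: conjugation
  along \<open>g\<close> is a homomorphism \<phi> from the group of \<open>F\<close> to that of
  \<open>N\<close>, injective by incompressibility, and \<open>g\<close> is chosen so that the
  picked element is \<phi> of the class of a curve of the slope. The descent takes place in the
  complement of the cyclic subgroup generated by that class. This complement is a union of cosets,
  so multiplication by the generator or its inverse does not leave it, and it misses the unit, so
  \<phi> maps it to non-trivial peripheral elements.\<close>

lemma cring_function_ring: "cring (function_ring X)"
proof (rule cringI)
  show "abelian_group (function_ring X)"
  proof (rule abelian_groupI)
    show "\<exists>y\<in>carrier (function_ring X). y \<oplus>\<^bsub>function_ring X\<^esub> f = \<zero>\<^bsub>function_ring X\<^esub>"
      if "f \<in> carrier (function_ring X)" for f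
      by (rule bexI[of _ "\<lambda>x\<in>X. - f x"]) (auto simp: function_ring_def fun_eq_iff)
  qed (auto simp: function_ring_def extensional_def fun_eq_iff)
  show "comm_monoid (function_ring X)"
    by unfold_locales (auto simp: function_ring_def extensional_def fun_eq_iff)
qed (auto simp: function_ring_def fun_eq_iff algebra_simps)

lemma a_inv_function_ring:
  assumes "f \<in> carrier (function_ring X)"
  shows "\<ominus>\<^bsub>function_ring X\<^esub> f = (\<lambda>x\<in>X. - f x)"
proof -
  interpret cring "function_ring X" by (rule cring_function_ring)
  show ?thesis
    using assms by (intro minus_equality) (auto simp: function_ring_def fun_eq_iff)
qed

text \<open>Each step of the generation is matched by an operation on polynomials. This turns
  membership in the abstract subring into a polynomial identity on \<open>X\<close>, to which
  degrees can be applied.\<close>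

lemma generate_ring_single_function:
  assumes "h \<in> generate_ring (function_ring X) (constant_functions X \<union> {trace_function X \<gamma>})"
  obtains p where "h = (\<lambda>\<xi>\<in>X. poly p (\<xi> \<gamma>))"
proof -
  have "\<exists>p. h = (\<lambda>\<xi>\<in>X. poly p (\<xi> \<gamma>))"
    using assms
  proof induction
    case one
    show ?case by (rule exI[of _ 1]) (auto simp: function_ring_def)
  next
    case (incl h)
    then consider c where "h = (\<lambda>\<xi>\<in>X. c)" | "h = trace_function X \<gamma>"
      by (auto simp: constant_functions_def)
    then show ?case
    proof cases
      case 1
      then show ?thesis by (intro exI[of _ "[:c:]"]) auto
    next
      case 2
      then show ?thesis by (intro exI[of _ "[:0, 1:]"]) (auto simp: trace_function_def)
    qed
  next
    case (a_inv h)
    then obtain p where p: "h = (\<lambda>\<xi>\<in>X. poly p (\<xi> \<gamma>))" by blast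
    show ?case
      unfolding p by (subst a_inv_function_ring) (auto simp: function_ring_def intro!: exI[of _ "-p"])
  next
    case (eng_add h1 h2)
    then obtain p q where "h1 = (\<lambda>\<xi>\<in>X. poly p (\<xi> \<gamma>))" "h2 = (\<lambda>\<xi>\<in>X. poly q (\<xi> \<gamma>))" by blast
    then show ?case
      by (intro exI[of _ "p + q"]) (auto simp: function_ring_def fun_eq_iff)
  next
    case (eng_mult h1 h2)
    then obtain p q where "h1 = (\<lambda>\<xi>\<in>X. poly p (\<xi> \<gamma>))" "h2 = (\<lambda>\<xi>\<in>X. poly q (\<xi> \<gamma>))" by blast
    then show ?case
      by (intro exI[of _ "p * q"]) (auto simp: function_ring_def fun_eq_iff)
  qed
  with that show ?thesis by blast
qed

text \<open>Horner's scheme: \<open>pCons a p\<close> stands for \<open>a\<close> plus the variable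
  times \<open>p\<close>, so one sum and one product extend membership from \<open>p\<close> to
  \<open>pCons a p\<close>.\<close>

lemma poly_trace_function_in_coordinate_ring:
  assumes "\<gamma> \<in> carrier G"
  shows "(\<lambda>\<xi>\<in>X. poly p (\<xi> \<gamma>)) \<in> coordinate_ring G X"
proof (induction p)
  case 0
  have "(\<lambda>\<xi>\<in>X. 0) \<in> constant_functions X" by (auto simp: constant_functions_def)
  then show ?case unfolding coordinate_ring_def poly_0 by (intro generate_ring.incl) blast
next
  case (pCons a p)
  let ?R = "function_ring X"
  have "(\<lambda>\<xi>\<in>X. a) \<in> coordinate_ring G X" "trace_function X \<gamma> \<in> coordinate_ring G X"
    using assms unfolding coordinate_ring_def
    by (auto intro!: generate_ring.incl simp: constant_functions_def)
  with pCons have "(\<lambda>\<xi>\<in>X. a) \<oplus>\<^bsub>?R\<^esub> (trace_function X \<gamma> \<otimes>\<^bsub>?R\<^esub> (\<lambda>\<xi>\<in>X. poly p (\<xi> \<gamma>)))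
      \<in> coordinate_ring G X"
    unfolding coordinate_ring_def by (intro generate_ring.eng_add generate_ring.eng_mult)
  also have "(\<lambda>\<xi>\<in>X. a) \<oplus>\<^bsub>?R\<^esub> (trace_function X \<gamma> \<otimes>\<^bsub>?R\<^esub> (\<lambda>\<xi>\<in>X. poly p (\<xi> \<gamma>)))
      = (\<lambda>\<xi>\<in>X. poly (pCons a p) (\<xi> \<gamma>))"
    by (auto simp: function_ring_def trace_function_def fun_eq_iff)
  finally show ?case .
qed

text \<open>One equation is added to those defining \<open>X\<close>. It has to be a function on all
  of \<open>characters G\<close>, where algebraic subsets are cut out.\<close>

lemma algebraic_subset_zeros:
  assumes "algebraic_subset G X" "\<gamma> \<in> carrier G"
  shows "algebraic_subset G {\<xi> \<in> X. poly p (\<xi> \<gamma>) = 0}"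
proof -
  from assms obtain F where F: "F \<subseteq> coordinate_ring G (characters G)"
    "X = {\<xi> \<in> characters G. \<forall>f\<in>F. f \<xi> = 0}"
    by (auto simp: algebraic_subset_def)
  let ?f = "\<lambda>\<xi>\<in>characters G. poly p (\<xi> \<gamma>)"
  have "insert ?f F \<subseteq> coordinate_ring G (characters G)"
    using F poly_trace_function_in_coordinate_ring[OF assms(2)] by auto
  moreover have "{\<xi> \<in> X. poly p (\<xi> \<gamma>) = 0} = {\<xi> \<in> characters G. \<forall>f\<in>insert ?f F. f \<xi> = 0}"
    using F by auto
  ultimately show ?thesis unfolding algebraic_subset_def by blast
qed

text \<open>With finitely many values, \<open>X\<close> is the union of one fibre \<open>A\<close>
  and of the remaining fibres \<open>B\<close>. Both are algebraic: \<open>A\<close> is cut out by a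
  linear polynomial, \<open>B\<close> by the product of the linear polynomials of the other values.
  As \<open>B\<close> misses \<xi>0, irreducibility leaves only \<open>A\<close>.\<close>

lemma trace_function_constant_if_finite_image:
  assumes "irreducible_algebraic_subset G X" "\<gamma> \<in> carrier G" "finite ((\<lambda>\<xi>. \<xi> \<gamma>) ` X)"
  shows "\<exists>c. \<forall>\<xi>\<in>X. \<xi> \<gamma> = c"
proof -
  from assms obtain \<xi>0 where \<xi>0: "\<xi>0 \<in> X" and alg: "algebraic_subset G X"
    by (auto simp: irreducible_algebraic_subset_def)
  define V where "V = (\<lambda>\<xi>. \<xi> \<gamma>) ` X - {\<xi>0 \<gamma>}"
  have V: "finite V" using assms by (simp add: V_def)
  define A where "A = {\<xi> \<in> X. poly [:- \<xi>0 \<gamma>, 1:] (\<xi> \<gamma>) = 0}"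
  define B where "B = {\<xi> \<in> X. poly (\<Prod>v\<in>V. [:- v, 1:]) (\<xi> \<gamma>) = 0}"
  have B: "B = {\<xi> \<in> X. \<xi> \<gamma> \<in> V}"
    using V by (auto simp: B_def poly_prod)
  have A: "A = {\<xi> \<in> X. \<xi> \<gamma> = \<xi>0 \<gamma>}"
    by (auto simp: A_def)
  have "algebraic_subset G A" "algebraic_subset G B"
    unfolding A_def B_def by (intro algebraic_subset_zeros alg assms(2))+
  moreover have "X = A \<union> B"
    unfolding A B V_def by auto
  moreover have "X \<noteq> B"
    using \<xi>0 unfolding B V_def by auto
  ultimately have "X = A"
    using assms(1) unfolding irreducible_algebraic_subset_def by blast
  with A show ?thesis by blast
qed

section \<open>Trace identities in SL2(C) and descent on the degree\<close>

lemma group_SL2C: "group SL2C"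
proof (rule groupI)
  fix A assume A: "A \<in> carrier SL2C"
  then have "invertible A" by (simp add: SL2C_def invertible_det_nz)
  then obtain B where B: "B ** A = mat 1" by (auto simp: invertible_def)
  then have "det B * det A = 1" by (metis det_I det_mul)
  with A B show "\<exists>B\<in>carrier SL2C. B \<otimes>\<^bsub>SL2C\<^esub> A = \<one>\<^bsub>SL2C\<^esub>"
    by (auto simp: SL2C_def)
qed (auto simp: SL2C_def det_mul matrix_mul_assoc)

text \<open>By Cayley-Hamilton the inverse of a matrix \<open>B\<close> of determinant 1 is
  \<open>mat (trace B) - B\<close>; the rest is linearity of the trace.\<close>

lemma trace_mult_add_trace_mult_inverse:
  fixes A B C :: "complex^2^2"
  assumes "det B = 1" "B ** C = mat 1"
  shows "trace (A ** B) + trace (A ** C) = trace A * trace B"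
proof -
  define D :: "complex^2^2" where "D = mat (trace B) - B"
  have "D ** B = mat 1"
    using assms(1)
    by (simp add: D_def vec_eq_iff forall_2 matrix_matrix_mult_def mat_def sum_2 trace_def det_2 algebra_simps)
  then have "C = D"
    by (metis assms(2) matrix_mul_assoc matrix_mul_lid matrix_mul_rid)
  show ?thesis
    unfolding \<open>C = D\<close> D_def by (simp add: matrix_matrix_mult_def mat_def sum_2 trace_def algebra_simps)
qed

lemma character_identities:
  fixes G (structure)
  assumes "group G" "\<xi> \<in> characters G"
  shows character_one: "\<xi> \<one>\<^bsub>G\<^esub> = 2"
    and character_mult_inv: "\<And>g h. g \<in> carrier G \<Longrightarrow> h \<in> carrier G \<Longrightarrow>
      \<xi> (g \<otimes>\<^bsub>G\<^esub> h) + \<xi> (g \<otimes>\<^bsub>G\<^esub> inv\<^bsub>G\<^esub> h) = \<xi> g * \<xi> h"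
proof -
  interpret group G by fact
  interpret S: group SL2C by (rule group_SL2C)
  from assms obtain \<rho> where \<rho>: "\<rho> \<in> hom G SL2C" and \<xi>: "\<xi> = (\<lambda>\<gamma>\<in>carrier G. trace (\<rho> \<gamma>))"
    by (auto simp: characters_def)
  interpret group_hom G SL2C \<rho> by unfold_locales (rule \<rho>)
  have "\<rho> \<one> = mat 1" using hom_one by (simp add: SL2C_def)
  then show "\<xi> \<one> = 2"
    by (simp add: \<xi> trace_def mat_def)
  fix g h assume gh: "g \<in> carrier G" "h \<in> carrier G"
  have "\<rho> h \<otimes>\<^bsub>SL2C\<^esub> \<rho> (inv h) = \<one>\<^bsub>SL2C\<^esub>"
    using gh by (simp flip: hom_mult)
  moreover have "\<rho> h \<in> carrier SL2C" using gh by simp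
  ultimately have "trace (\<rho> g ** \<rho> h) + trace (\<rho> g ** \<rho> (inv h)) = trace (\<rho> g) * trace (\<rho> h)"
    by (intro trace_mult_add_trace_mult_inverse) (auto simp: SL2C_def)
  moreover have "\<rho> (g \<otimes> h) = \<rho> g ** \<rho> h" "\<rho> (g \<otimes> inv h) = \<rho> g ** \<rho> (inv h)"
    using gh by (simp_all add: SL2C_def)
  ultimately show "\<xi> (g \<otimes> h) + \<xi> (g \<otimes> inv h) = \<xi> g * \<xi> h"
    using gh by (simp add: \<xi>)
qed

text \<open>For commuting elements this is Fricke's identity with the commutator trace set to 2.\<close>

lemma character_mult_commuting:
  fixes G (structure)
  assumes "group G" "\<xi> \<in> characters G" "g \<in> carrier G" "h \<in> carrier G"
    and comm: "g \<otimes>\<^bsub>G\<^esub> h = h \<otimes>\<^bsub>G\<^esub> g"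
  shows "\<xi> (g \<otimes>\<^bsub>G\<^esub> h) * \<xi> (g \<otimes>\<^bsub>G\<^esub> inv\<^bsub>G\<^esub> h) = (\<xi> g)\<^sup>2 + (\<xi> h)\<^sup>2 - 4"
proof -
  interpret group G by fact
  note id = character_mult_inv[OF assms(1,2)]
  \<comment> \<open>The sum formula is going to be applied to the pair \<open>g \<otimes> h\<close>,
    \<open>g \<otimes> inv h\<close>, whose product and quotient are the squares of \<open>g\<close>
    and \<open>h\<close>.\<close>
  have 1: "(g \<otimes> h) \<otimes> (g \<otimes> inv h) = g \<otimes> g"
    using assms(3,4) comm by (smt (verit) inv_closed m_assoc m_closed r_inv r_one)
  have 2: "(g \<otimes> h) \<otimes> inv (g \<otimes> inv h) = h \<otimes> h"
    using assms(3,4) comm by (smt (verit) inv_closed inv_inv inv_mult_group m_assoc m_closed r_inv r_one)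
  have "\<xi> (g \<otimes> h) * \<xi> (g \<otimes> inv h) = \<xi> (g \<otimes> g) + \<xi> (h \<otimes> h)"
    using id[of "g \<otimes> h" "g \<otimes> inv h"] assms(3,4) by (simp add: 1 2)
  \<comment> \<open>The sum formula with equal arguments: the quotient is the unit, whose character
    is 2. The two subtractions make up the constant 4.\<close>
  moreover have "\<xi> (g \<otimes> g) = \<xi> g * \<xi> g - 2" "\<xi> (h \<otimes> h) = \<xi> h * \<xi> h - 2"
    using id[of g g] id[of h h] assms(3,4) character_one[OF assms(1,2)]
    by (simp_all add: eq_diff_eq)
  ultimately show ?thesis
    by (simp add: power2_eq_square)
qed

text \<open>
  Descent on the degree: for \<open>\<delta>\<close> with polynomial \<open>p\<close> of minimal degree \<open>n\<close>, the polynomials of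
  \<open>\<delta>\<gamma>\<close> and \<open>\<delta>\<gamma>\<^sup>-\<^sup>1\<close> have a sum of degree \<open>n + 1\<close> and a product of degree at most \<open>2n\<close>, so one of them
  has degree less than \<open>n\<close>.
\<close>

lemma not_all_traces_polynomial:
  fixes G :: "'g monoid"
  assumes G: "group G" and X: "irreducible_algebraic_subset G X" and \<gamma>: "\<gamma> \<in> carrier G"
    and S: "S \<subseteq> carrier G" "S \<noteq> {}"
    and comm: "\<And>\<delta>. \<delta> \<in> S \<Longrightarrow> \<delta> \<otimes>\<^bsub>G\<^esub> \<gamma> = \<gamma> \<otimes>\<^bsub>G\<^esub> \<delta>"
    and closed: "\<And>\<delta>. \<delta> \<in> S \<Longrightarrow> \<delta> \<otimes>\<^bsub>G\<^esub> \<gamma> \<in> S" "\<And>\<delta>. \<delta> \<in> S \<Longrightarrow> \<delta> \<otimes>\<^bsub>G\<^esub> inv\<^bsub>G\<^esub> \<gamma> \<in> S"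
    and nonconst: "\<And>\<delta>. \<delta> \<in> S \<Longrightarrow> trace_function X \<delta> \<notin> constant_functions X"
    and polynomial: "\<And>\<delta>. \<delta> \<in> S \<Longrightarrow> \<exists>p. \<forall>\<xi>\<in>X. \<xi> \<delta> = poly p (\<xi> \<gamma>)"
  shows False
proof -
  have sub: "X \<subseteq> characters G"
    using X by (auto simp: irreducible_algebraic_subset_def algebraic_subset_def)
  have nc: "\<not> (\<forall>\<xi>\<in>X. \<xi> \<delta> = c)" if "\<delta> \<in> S" for \<delta> c
  proof
    assume "\<forall>\<xi>\<in>X. \<xi> \<delta> = c"
    then have "trace_function X \<delta> = (\<lambda>\<xi>\<in>X. c)" by (auto simp: trace_function_def)
    with nonconst[OF that] show False by (auto simp: constant_functions_def)
  qed
  \<comment> \<open>If \<open>I_\<gamma>\<close> had finitely many values it would be constant, and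
    so would every polynomial in it, in particular the trace function of an element of
    \<open>S\<close>.\<close>
  have inf: "infinite ((\<lambda>\<xi>. \<xi> \<gamma>) ` X)"
  proof
    assume "finite ((\<lambda>\<xi>. \<xi> \<gamma>) ` X)"
    then obtain c where c: "\<forall>\<xi>\<in>X. \<xi> \<gamma> = c"
      using trace_function_constant_if_finite_image[OF X \<gamma>] by blast
    obtain \<delta> where \<delta>: "\<delta> \<in> S" using S by blast
    then obtain p where "\<forall>\<xi>\<in>X. \<xi> \<delta> = poly p (\<xi> \<gamma>)" using polynomial by blast
    with c nc[OF \<delta>, of "poly p c"] show False by simp
  qed
  have poly_eqI: "p = q" if "\<And>\<xi>. \<xi> \<in> X \<Longrightarrow> poly p (\<xi> \<gamma>) = poly q (\<xi> \<gamma>)" for p q :: "complex poly"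
  proof (rule ccontr)
    assume "p \<noteq> q"
    then have "finite {z. poly (p - q) z = 0}" by (intro poly_roots_finite) auto
    then have "finite ((\<lambda>\<xi>. \<xi> \<gamma>) ` X)" by (rule rev_finite_subset) (auto simp: that)
    with inf show False by blast
  qed
  define Q where "Q p \<longleftrightarrow> (\<exists>\<delta>\<in>S. \<forall>\<xi>\<in>X. \<xi> \<delta> = poly p (\<xi> \<gamma>))" for p
  have "\<exists>p. Q p" using S polynomial unfolding Q_def by blast
  then obtain p where "Q p" and min: "\<And>q. Q q \<Longrightarrow> degree p \<le> degree q"
    using ex_has_least_nat[of Q _ degree] by blast
  then obtain \<delta> where \<delta>: "\<delta> \<in> S" "\<And>\<xi>. \<xi> \<in> X \<Longrightarrow> \<xi> \<delta> = poly p (\<xi> \<gamma>)"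
    by (auto simp: Q_def)
  obtain q where q: "\<And>\<xi>. \<xi> \<in> X \<Longrightarrow> \<xi> (\<delta> \<otimes>\<^bsub>G\<^esub> \<gamma>) = poly q (\<xi> \<gamma>)"
    using polynomial[OF closed(1)] \<delta> by blast
  obtain r where r: "\<And>\<xi>. \<xi> \<in> X \<Longrightarrow> \<xi> (\<delta> \<otimes>\<^bsub>G\<^esub> inv\<^bsub>G\<^esub> \<gamma>) = poly r (\<xi> \<gamma>)"
    using polynomial[OF closed(2)] \<delta> by blast
  \<comment> \<open>Positive degree keeps \<open>p\<close>, and through \<open>le\<close> also
    \<open>q\<close> and \<open>r\<close>, away from 0, so that degrees of products add up. It also
    makes \<open>2 * degree p\<close> at least 2, the degree of \<open>[:-4, 0, 1:]\<close>.\<close>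
  have deg: "degree p > 0"
  proof (rule ccontr)
    assume "\<not> degree p > 0"
    then obtain c where "p = [:c:]" by (auto elim: degree_eq_zeroE)
    with \<delta> nc[of \<delta> c] show False by auto
  qed
  have le: "degree p \<le> degree q" "degree p \<le> degree r"
    using min closed \<delta> q r unfolding Q_def by blast+
  have \<delta>G: "\<delta> \<in> carrier G" using \<delta> S by blast
  \<comment> \<open>\<open>[:0, 1:]\<close> is the polynomial of \<gamma> itself; below,
    \<open>[:-4, 0, 1:]\<close> is that of \<open>I_\<gamma>^2 - 4\<close>.\<close>
  have sum: "q + r = [:0, 1:] * p"
  proof (rule poly_eqI)
    fix \<xi> assume "\<xi> \<in> X"
    then show "poly (q + r) (\<xi> \<gamma>) = poly ([:0, 1:] * p) (\<xi> \<gamma>)"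
      using character_mult_inv[OF G, of \<xi> \<delta> \<gamma>] \<delta> q r sub \<gamma> \<delta>G by (auto simp: mult.commute)
  qed
  have prod: "q * r = p ^ 2 + [:-4, 0, 1:]"
  proof (rule poly_eqI)
    fix \<xi> assume "\<xi> \<in> X"
    then show "poly (q * r) (\<xi> \<gamma>) = poly (p ^ 2 + [:-4, 0, 1:]) (\<xi> \<gamma>)"
      using character_mult_commuting[OF G, of \<xi> \<delta> \<gamma>] \<delta> q r sub \<gamma> \<delta>G comm
      by (auto simp: power2_eq_square algebra_simps)
  qed
  have "degree p + 1 = degree ([:0, 1:] * p)"
    using deg by (subst degree_mult_eq) auto
  also have "\<dots> \<le> max (degree q) (degree r)"
    unfolding sum[symmetric] by (rule degree_add_le_max)
  finally have "degree p + 1 \<le> max (degree q) (degree r)" .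
  moreover have "degree q + degree r = degree (q * r)"
    using le deg by (subst degree_mult_eq) auto
  moreover have "degree (q * r) \<le> 2 * degree p"
    unfolding prod using deg degree_power_le[of p 2] by (intro degree_add_le) auto
  ultimately show False
    using le by linarith
qed

section \<open>Modules with at most one generator\<close>

text \<open>Suppose that \<open>s\<close> alone generates \<open>M\<close>. Then 1 = us and ss = vs
  with \<open>u\<close>, \<open>v\<close> in \<open>K\<close>, hence s = s(us) = u(ss) = v(us) = v.
  So \<open>s\<close> is in \<open>K\<close>, and with it all of \<open>M\<close>. The empty
  generating set would give only zero, but \<open>M\<close> contains 1.\<close>

lemma module_rank_ge_2:
  fixes R (structure)
  assumes R: "cring R" and K: "subring K R" and M: "M \<subseteq> carrier R"
    and one: "\<one>\<^bsub>R\<^esub> \<in> M" "\<one>\<^bsub>R\<^esub> \<noteq> \<zero>\<^bsub>R\<^esub>" and mult: "\<And>s. s \<in> M \<Longrightarrow> s \<otimes>\<^bsub>R\<^esub> s \<in> M"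
    and nsub: "\<not> M \<subseteq> K"
  shows "module_rank R K M \<ge> 2"
  unfolding module_rank_def
proof (rule Inf_greatest)
  interpret cring R by fact
  interpret K: subring K R by fact
  fix k
  assume "k \<in> {enat (card S) | S. finite S \<and> S \<subseteq> M \<and>
    M = {(\<Oplus>s\<in>S. a s \<otimes> s) | a. a \<in> S \<rightarrow> K}}"
  then obtain S where k: "k = enat (card S)" and S: "finite S" "S \<subseteq> M"
    and M': "M = {(\<Oplus>s\<in>S. a s \<otimes> s) | a. a \<in> S \<rightarrow> K}"
    by blast
  have "\<not> card S < 2"
  proof
    assume "card S < 2"
    then have "card S = 0 \<or> card S = 1" by linarith
    then show False
    proof
      assume "card S = 0"
      then have "M \<subseteq> {\<zero>}" using S M' by auto
      with one show False by blast
    next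
      assume "card S = 1"
      then obtain s where s: "S = {s}" by (auto simp: card_1_singleton_iff)
      have sR: "s \<in> carrier R" using S s M by auto
      have ex: "\<exists>k\<in>K. y = k \<otimes> s" if "y \<in> M" for y
      proof -
        from that M' obtain a where a: "y = (\<Oplus>t\<in>S. a t \<otimes> t)" "a \<in> S \<rightarrow> K" by blast
        then have "y = a s \<otimes> s" "a s \<in> K"
          using s sR K.subset by (auto simp: finsum_insert)
        then show ?thesis by blast
      qed
      obtain u where u: "u \<in> K" "\<one> = u \<otimes> s" using ex one by blast
      obtain v where v: "v \<in> K" "s \<otimes> s = v \<otimes> s" using ex mult S s by blast
      have uv: "u \<in> carrier R" "v \<in> carrier R" using u v K.subset by auto
      have "s = s \<otimes> (u \<otimes> s)" using sR by (simp flip: u(2))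
      also have "\<dots> = u \<otimes> (s \<otimes> s)" using uv sR by (simp add: m_ac)
      also have "\<dots> = v \<otimes> (u \<otimes> s)" unfolding v using uv sR by (simp add: m_ac)
      also have "\<dots> = v" using uv by (simp flip: u(2))
      finally have "s \<in> K" using v by simp
      then have "M \<subseteq> K" using ex K.m_closed by blast
      with nsub show False by blast
    qed
  qed
  then show "2 \<le> k"
    by (simp add: k numeral_eq_enat)
qed

text \<open>The trace function of \<delta> itself witnesses that the coordinate ring is larger than
  the subring. The rank bound is thus reduced to finding one trace function that is not a polynomial
  in that of \<gamma>. A point of \<open>X\<close> is what separates 1 from 0 in the function
  ring.\<close>

lemma module_rank_single_trace_ge_2:
  fixes G :: "'g monoid"
  assumes X: "X \<noteq> {}"
    and \<delta>: "\<delta> \<in> carrier G" "\<nexists>p. \<forall>\<xi>\<in>X. \<xi> \<delta> = poly p (\<xi> \<gamma>)"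
  shows "module_rank (function_ring X)
       (generate_ring (function_ring X) (constant_functions X \<union> {trace_function X \<gamma>}))
       (coordinate_ring G X) \<ge> 2"
proof -
  interpret cring "function_ring X" by (rule cring_function_ring)
  have carrier: "constant_functions X \<union> {trace_function X \<gamma>} \<subseteq> carrier (function_ring X)"
    "constant_functions X \<union> trace_function X ` carrier G \<subseteq> carrier (function_ring X)"
    by (auto simp: constant_functions_def trace_function_def function_ring_def)
  show ?thesis
  proof (rule module_rank_ge_2)
    show "cring (function_ring X)" by (rule cring_function_ring)
    show "subring (generate_ring (function_ring X) (constant_functions X \<union> {trace_function X \<gamma>}))
      (function_ring X)" by (intro generate_ring_is_subring carrier)
    show "coordinate_ring G X \<subseteq> carrier (function_ring X)"
      unfolding coordinate_ring_def by (intro generate_ring_incl carrier)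
    show "\<one>\<^bsub>function_ring X\<^esub> \<in> coordinate_ring G X"
      unfolding coordinate_ring_def by (rule generate_ring.one)
    show "\<one>\<^bsub>function_ring X\<^esub> \<noteq> \<zero>\<^bsub>function_ring X\<^esub>"
      using X by (auto simp: function_ring_def fun_eq_iff)
    show "s \<otimes>\<^bsub>function_ring X\<^esub> s \<in> coordinate_ring G X" if "s \<in> coordinate_ring G X" for s
      using that unfolding coordinate_ring_def by (intro generate_ring.eng_mult)
    have "trace_function X \<delta> \<in> coordinate_ring G X"
      using \<delta> unfolding coordinate_ring_def by (intro generate_ring.incl) auto
    moreover have "trace_function X \<delta> \<notin>
      generate_ring (function_ring X) (constant_functions X \<union> {trace_function X \<gamma>})"
    proof
      assume "trace_function X \<delta> \<in>
        generate_ring (function_ring X) (constant_functions X \<union> {trace_function X \<gamma>})"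
      then obtain p where "trace_function X \<delta> = (\<lambda>\<xi>\<in>X. poly p (\<xi> \<gamma>))"
        by (rule generate_ring_single_function)
      then have "\<forall>\<xi>\<in>X. \<xi> \<delta> = poly p (\<xi> \<gamma>)"
        by (auto simp: trace_function_def fun_eq_iff restrict_def split: if_splits)
      with \<delta> show False by blast
    qed
    ultimately show "\<not> coordinate_ring G X \<subseteq>
      generate_ring (function_ring X) (constant_functions X \<union> {trace_function X \<gamma>})" by blast
  qed
qed

section \<open>Homotopies of paths and loops\<close>

text \<open>The straight-line homotopy in \<open>C\<close> is pushed forward by \<open>h\<close>.
  Since \<open>S\<close> lies in an arbitrary topological space, homotopies in it are produced by
  drawing two paths in an interval or a square and mapping them.\<close>

lemma homotopic_paths_convex_image:
  fixes h :: "'b::real_normed_vector \<Rightarrow> 'a::topological_space"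
  assumes "convex C" "continuous_on C h" "h ` C \<subseteq> S"
    and "path f" "path_image f \<subseteq> C" "path g" "path_image g \<subseteq> C"
    and "pathstart g = pathstart f" "pathfinish g = pathfinish f"
  shows "homotopic_paths S (h \<circ> f) (h \<circ> g)"
proof (rule homotopic_paths_continuous_image)
  show "homotopic_paths C f g"
  proof (rule homotopic_paths_linear)
    fix t :: real assume "t \<in> {0..1}"
    with assms show "closed_segment (f t) (g t) \<subseteq> C"
      by (intro closed_segment_subset) (auto simp: path_image_def)
  qed (use assms in auto)
qed (use assms in auto)

text \<open>Both sides are \<open>p\<close> composed with a path from 0 to 1 in the unit interval,
  and any two such paths are homotopic there.\<close>

lemma homotopic_paths_const_left:
  fixes p :: "real \<Rightarrow> 'a::topological_space"
  assumes "path p" "path_image p \<subseteq> S"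
  shows "homotopic_paths S ((\<lambda>_. pathstart p) +++ p) p"
proof -
  have "path_image (linepath 0 0 +++ linepath 0 1) \<subseteq> {0..1::real}"
    by (intro subset_path_image_join) (auto simp: closed_segment_eq_real_ivl)
  with assms have "homotopic_paths S (p \<circ> (linepath 0 0 +++ linepath 0 1)) (p \<circ> linepath 0 1)"
    by (intro homotopic_paths_convex_image[where C = "{0..1}"])
      (auto simp: path_def path_image_def closed_segment_eq_real_ivl simp flip: path_def)
  moreover have "p \<circ> linepath 0 0 = (\<lambda>_. pathstart p)" "p \<circ> linepath 0 1 = p"
    by (auto simp: linepath_def pathstart_def)
  ultimately show ?thesis by (simp add: path_compose_join)
qed

lemma homotopic_paths_const_right:
  fixes p :: "real \<Rightarrow> 'a::topological_space"
  assumes "path p" "path_image p \<subseteq> S"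
  shows "homotopic_paths S (p +++ (\<lambda>_. pathfinish p)) p"
proof -
  have "homotopic_paths S (reversepath ((\<lambda>_. pathfinish p) +++ reversepath p)) (reversepath (reversepath p))"
    using homotopic_paths_const_left[of "reversepath p" S] assms
    by (subst homotopic_paths_reversepath) simp_all
  moreover have "reversepath (\<lambda>_. pathfinish p) = (\<lambda>_. pathfinish p)"
    by (simp add: reversepath_def)
  moreover have "reversepath ((\<lambda>_. pathfinish p) +++ reversepath p)
      = reversepath (reversepath p) +++ reversepath (\<lambda>_. pathfinish p)"
    by (rule reversepath_joinpaths) (simp add: pathfinish_def pathstart_def reversepath_def)
  ultimately show ?thesis by simp
qed

text \<open>The left side is \<open>p\<close> composed with the path from 0 to 1 and back, which
  contracts to 0 inside the unit interval.\<close>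

lemma homotopic_paths_inv_right:
  fixes p :: "real \<Rightarrow> 'a::topological_space"
  assumes "path p" "path_image p \<subseteq> S"
  shows "homotopic_paths S (p +++ reversepath p) (\<lambda>_. pathstart p)"
proof -
  have "path_image (linepath 0 1 +++ linepath 1 0) \<subseteq> {0..1::real}"
    by (intro subset_path_image_join) (auto simp: closed_segment_eq_real_ivl)
  with assms have "homotopic_paths S (p \<circ> (linepath 0 1 +++ linepath 1 0)) (p \<circ> linepath 0 0)"
    by (intro homotopic_paths_convex_image[where C = "{0..1}"]) (auto simp: path_def path_image_def simp flip: path_def)
  moreover have "p \<circ> linepath 0 0 = (\<lambda>_. pathstart p)" "p \<circ> linepath 0 1 = p" "p \<circ> linepath 1 0 = reversepath p"
    by (auto simp: linepath_def pathstart_def reversepath_def)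
  ultimately show ?thesis by (simp add: path_compose_join)
qed

lemma homotopic_paths_inv_left:
  fixes p :: "real \<Rightarrow> 'a::topological_space"
  assumes "path p" "path_image p \<subseteq> S"
  shows "homotopic_paths S (reversepath p +++ p) (\<lambda>_. pathfinish p)"
  using homotopic_paths_inv_right[of "reversepath p" S] assms by simp

lemma homotopic_paths_cancel_left:
  fixes g :: "real \<Rightarrow> 'a::topological_space"
  assumes "path g" "path_image g \<subseteq> S" "path r" "path_image r \<subseteq> S" "pathstart r = pathfinish g"
  shows "homotopic_paths S (reversepath g +++ (g +++ r)) r"
proof -
  have "homotopic_paths S (reversepath g +++ (g +++ r)) ((reversepath g +++ g) +++ r)"
    using assms by (intro homotopic_paths_assoc) auto
  also have "homotopic_paths S \<dots> ((\<lambda>_. pathstart r) +++ r)"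
    using assms homotopic_paths_inv_left[of g S] by (intro homotopic_paths_join) auto
  also have "homotopic_paths S \<dots> r"
    using assms by (intro homotopic_paths_const_left) auto
  finally show ?thesis .
qed

lemma homotopic_paths_cancel_right:
  fixes g :: "real \<Rightarrow> 'a::topological_space"
  assumes "path g" "path_image g \<subseteq> S" "path r" "path_image r \<subseteq> S" "pathfinish r = pathfinish g"
  shows "homotopic_paths S ((r +++ reversepath g) +++ g) r"
proof -
  have "homotopic_paths S (r +++ (reversepath g +++ g)) ((r +++ reversepath g) +++ g)"
    using assms by (intro homotopic_paths_assoc) auto
  then have "homotopic_paths S ((r +++ reversepath g) +++ g) (r +++ (reversepath g +++ g))"
    by (rule homotopic_paths_sym)
  also have "homotopic_paths S \<dots> (r +++ (\<lambda>_. pathfinish r))"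
    using assms homotopic_paths_inv_left[of g S] by (intro homotopic_paths_join) auto
  also have "homotopic_paths S \<dots> r"
    using assms by (intro homotopic_paths_const_right) auto
  finally show ?thesis .
qed

section \<open>Conjugation along a path and free homotopy\<close>

text \<open>The inner \<open>reversepath g\<close> and \<open>g\<close> cancel. On path classes this
  says that conjugation along \<open>g\<close> is multiplicative.\<close>

lemma homotopic_paths_conjugate_join:
  fixes g :: "real \<Rightarrow> 'a::topological_space"
  assumes g: "path g" "path_image g \<subseteq> S"
    and m: "path m" "path_image m \<subseteq> S" "pathstart m = pathfinish g" "pathfinish m = pathfinish g"
    and n: "path n" "path_image n \<subseteq> S" "pathstart n = pathfinish g" "pathfinish n = pathfinish g"
  shows "homotopic_paths S ((g +++ (m +++ reversepath g)) +++ (g +++ (n +++ reversepath g)))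
    (g +++ ((m +++ n) +++ reversepath g))"
proof -
  let ?n = "n +++ reversepath g"
  note sub = subset_path_image_join
  have "homotopic_paths S ((m +++ reversepath g) +++ (g +++ ?n)) (m +++ (reversepath g +++ (g +++ ?n)))"
    using assms by (intro homotopic_paths_sym[OF homotopic_paths_assoc] sub) (auto simp: sub)
  also have "homotopic_paths S \<dots> (m +++ ?n)"
    using assms by (intro homotopic_paths_join homotopic_paths_cancel_left sub) (auto simp: sub)
  also have "homotopic_paths S \<dots> ((m +++ n) +++ reversepath g)"
    using assms by (intro homotopic_paths_assoc) auto
  finally have 1: "homotopic_paths S ((m +++ reversepath g) +++ (g +++ ?n)) ((m +++ n) +++ reversepath g)" .
  have "homotopic_paths S ((g +++ (m +++ reversepath g)) +++ (g +++ ?n))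
      (g +++ ((m +++ reversepath g) +++ (g +++ ?n)))"
    using assms by (intro homotopic_paths_sym[OF homotopic_paths_assoc] sub) (auto simp: sub)
  also have "homotopic_paths S \<dots> (g +++ ((m +++ n) +++ reversepath g))"
    using assms by (intro homotopic_paths_join[OF _ 1]) auto
  finally show ?thesis .
qed

text \<open>Composing with \<open>reversepath g\<close> on the left and with \<open>g\<close> on the
  right undoes the conjugation. On path classes this is injectivity of the change of base
  point.\<close>

lemma homotopic_paths_conjugate_cancel:
  fixes g :: "real \<Rightarrow> 'a::topological_space"
  assumes g: "path g" "path_image g \<subseteq> S"
    and m: "path m" "path_image m \<subseteq> S" "pathstart m = pathfinish g" "pathfinish m = pathfinish g"
    and n: "path n" "path_image n \<subseteq> S" "pathstart n = pathfinish g" "pathfinish n = pathfinish g"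
    and hom: "homotopic_paths S (g +++ (m +++ reversepath g)) (g +++ (n +++ reversepath g))"
  shows "homotopic_paths S m n"
proof -
  have left: "homotopic_paths S (reversepath g +++ (g +++ (l +++ reversepath g))) (l +++ reversepath g)"
    and right: "homotopic_paths S ((l +++ reversepath g) +++ g) l" if "l = m \<or> l = n" for l
    using assms that by (auto intro!: homotopic_paths_cancel_left homotopic_paths_cancel_right simp: path_image_join)
  have "homotopic_paths S (m +++ reversepath g) (reversepath g +++ (g +++ (m +++ reversepath g)))"
    by (rule homotopic_paths_sym) (simp add: left)
  also have "homotopic_paths S \<dots> (reversepath g +++ (g +++ (n +++ reversepath g)))"
    using assms by (intro homotopic_paths_join hom) auto
  also have "homotopic_paths S \<dots> (n +++ reversepath g)"
    by (simp add: left)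
  finally have 1: "homotopic_paths S (m +++ reversepath g) (n +++ reversepath g)" .
  have "homotopic_paths S m ((m +++ reversepath g) +++ g)"
    by (rule homotopic_paths_sym) (simp add: right)
  also have "homotopic_paths S \<dots> ((n +++ reversepath g) +++ g)"
    using assms by (intro homotopic_paths_join[OF 1]) auto
  also have "homotopic_paths S \<dots> n"
    by (simp add: right)
  finally show ?thesis .
qed

text \<open>The loop is traversed twice, and the starting point of a window of half its length is moved.\<close>

lemma homotopic_loops_cyclic:
  fixes p :: "real \<Rightarrow> 'a::topological_space"
  assumes p: "path p" "path_image p \<subseteq> S" and q: "path q" "path_image q \<subseteq> S"
    and pq: "pathfinish p = pathstart q" "pathfinish q = pathstart p"
  shows "homotopic_loops S (p +++ q) (q +++ p)"
proof -
  define f where "f = (p +++ q) +++ (p +++ q)"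
  have "path f" "path_image f \<subseteq> S"
    using assms by (auto simp: f_def subset_path_image_join)
  then have f: "continuous_on {0..1} f" "f ` {0..1} \<subseteq> S"
    by (auto simp: path_def path_image_def)
  \<comment> \<open>In \<open>f\<close> each copy of \<open>p +++ q\<close> has length 1/2 and each
    of its two pieces length 1/4. Hence the window starting at 0 reads \<open>p +++ q\<close> and
    the one starting at 1/4 reads \<open>q +++ p\<close>. Its length is the period of
    \<open>f\<close>, so every stage in between is closed.\<close>
  have "continuous_on ({0..1} \<times> {0..1}) (\<lambda>z. f (fst z / 4 + snd z / 2))"
    by (rule continuous_on_compose2[OF f(1)]) (auto intro!: continuous_intros)
  moreover have "(\<lambda>z. f (fst z / 4 + snd z / 2)) \<in> ({0..1} \<times> {0..1}) \<rightarrow> S"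
    using f(2) by (auto simp: image_subset_iff)
  moreover have "f (x / 2) = (p +++ q) x" if "x \<in> {0..1}" for x
    using that by (auto simp: f_def joinpaths_def)
  moreover have "f (1 / 4 + x / 2) = (q +++ p) x" if "x \<in> {0..1}" for x
    using that pq by (auto simp: f_def joinpaths_def pathstart_def pathfinish_def diff_divide_distrib add_divide_distrib)
  moreover have "f (s / 4 + 1 / 2) = f (s / 4)" if "s \<in> {0..1}" for s
    using that pq by (auto simp: f_def joinpaths_def pathstart_def pathfinish_def field_simps)
  ultimately show ?thesis
    unfolding homotopic_loops
    by (intro exI[of _ "\<lambda>z. f (fst z / 4 + snd z / 2)"]) (auto simp: pathstart_def pathfinish_def)
qed

text \<open>A cyclic rotation puts \<open>reversepath g\<close> next to \<open>g\<close>, where they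
  cancel.\<close>

lemma homotopic_loops_conjugate_top:
  fixes g :: "real \<Rightarrow> 'a::topological_space"
  assumes g: "path g" "path_image g \<subseteq> S"
    and m: "path m" "path_image m \<subseteq> S" "pathstart m = pathfinish g" "pathfinish m = pathfinish g"
  shows "homotopic_loops S (g +++ (m +++ reversepath g)) m"
proof -
  have "homotopic_loops S (g +++ (m +++ reversepath g)) ((m +++ reversepath g) +++ g)"
    using assms by (intro homotopic_loops_cyclic subset_path_image_join) auto
  moreover have "homotopic_loops S ((m +++ reversepath g) +++ g) m"
    using assms by (intro homotopic_paths_imp_homotopic_loops homotopic_paths_cancel_right) auto
  ultimately show ?thesis
    by (rule homotopic_loops_trans)
qed

text \<open>The base point traces the conjugating path.\<close>

lemma homotopic_loops_imp_conjugate: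
  fixes p :: "real \<Rightarrow> 'a::topological_space"
  assumes "homotopic_loops S p c"
  obtains g where "path g" "path_image g \<subseteq> S" "pathstart g = pathstart p" "pathfinish g = pathstart c"
    "homotopic_paths S p (g +++ (c +++ reversepath g))"
proof -
  from assms obtain h where h: "continuous_on ({0..1::real} \<times> {0..1::real}) h"
    "h \<in> ({0..1} \<times> {0..1}) \<rightarrow> S"
    and p: "\<And>x. x \<in> {0..1} \<Longrightarrow> h (0, x) = p x" and c: "\<And>x. x \<in> {0..1} \<Longrightarrow> h (1, x) = c x"
    and loop: "\<And>t. t \<in> {0..1} \<Longrightarrow> h (t, 1) = h (t, 0)"
    unfolding homotopic_loops by (auto simp: pathstart_def pathfinish_def)
  define g where "g s = h (s, 0)" for s
  \<comment> \<open>\<open>?\<sigma>\<close> is the edge of the square on which \<open>h\<close> is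
    \<open>p\<close>. \<open>?\<tau>\<close> runs along the other three edges, on which
    \<open>h\<close> is \<open>g\<close>, then \<open>c\<close>, then \<open>g\<close> backwards
    because each stage of the homotopy is closed.\<close>
  let ?\<sigma> = "linepath (0, 0) (0, 1) :: real \<Rightarrow> real \<times> real"
  let ?\<tau> = "linepath (0, 0) (1, 0) +++ (linepath (1, 0) (1, 1) +++ linepath (1, 1) (0, 1)) :: real \<Rightarrow> real \<times> real"
  have convex: "convex ({0..1::real} \<times> {0..1::real})"
    by (intro convex_Times) auto
  have sub: "path_image ?\<sigma> \<subseteq> {0..1} \<times> {0..1}"
    using convex by (simp add: closed_segment_subset)
  have sub': "path_image ?\<tau> \<subseteq> {0..1} \<times> {0..1}"
    using convex by (intro subset_path_image_join; simp add: closed_segment_subset)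
  have hom: "homotopic_paths S (h \<circ> ?\<sigma>) (h \<circ> ?\<tau>)"
    using h sub sub' by (intro homotopic_paths_convex_image[OF convex]) auto
  have paths: "path p" "path_image p \<subseteq> S" "path c" "path_image c \<subseteq> S"
    using homotopic_loops_imp_path[OF assms] homotopic_loops_imp_subset[OF assms] by auto
  have g: "path g" "path_image g \<subseteq> S"
    using h unfolding path_def path_image_def g_def
    by (auto intro!: continuous_on_compose2[OF h(1)] continuous_intros)
  have ends: "pathstart g = pathstart p" "pathfinish g = pathstart c"
    using p[of 0] c[of 0] by (auto simp: g_def pathstart_def pathfinish_def)
  have cl: "pathfinish c = pathstart c"
    using homotopic_loops_imp_loop[OF assms] by auto
  have "homotopic_paths S p (h \<circ> ?\<sigma>)"
    using paths p by (intro homotopic_paths_eq) (auto simp: linepath_def)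
  also note hom
  also have "homotopic_paths S (h \<circ> ?\<tau>) (g +++ (c +++ reversepath g))"
  proof (rule homotopic_paths_sym, rule homotopic_paths_eq)
    show "path (g +++ (c +++ reversepath g))" "path_image (g +++ (c +++ reversepath g)) \<subseteq> S"
      using g ends paths cl by (auto simp: subset_path_image_join)
    fix t :: real assume "t \<in> {0..1}"
    then show "(g +++ (c +++ reversepath g)) t = (h \<circ> ?\<tau>) t"
      using c loop by (auto simp: joinpaths_def linepath_def g_def reversepath_def)
  qed
  finally show ?thesis using that g ends by blast
qed

section \<open>The fundamental group\<close>

definition loops_at :: "'a::topological_space set \<Rightarrow> 'a \<Rightarrow> (real \<Rightarrow> 'a) set" where
  "loops_at S x = {p. path p \<and> path_image p \<subseteq> S \<and> pathstart p = x \<and> pathfinish p = x}"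

definition path_class :: "'a::topological_space set \<Rightarrow> (real \<Rightarrow> 'a) \<Rightarrow> (real \<Rightarrow> 'a) set" where
  "path_class S p = {q. homotopic_paths S p q}"

lemma loops_atD:
  assumes "p \<in> loops_at S x"
  shows "path p" "path_image p \<subseteq> S" "pathstart p = x" "pathfinish p = x"
  using assms by (auto simp: loops_at_def)

lemma loops_at_closed:
  assumes "p \<in> loops_at S x"
  shows "q \<in> loops_at S x \<Longrightarrow> p +++ q \<in> loops_at S x" "reversepath p \<in> loops_at S x"
  using assms by (auto simp: loops_at_def subset_path_image_join)

lemma const_in_loops_at: "x \<in> S \<Longrightarrow> (\<lambda>_. x) \<in> loops_at S x"
  by (auto simp: loops_at_def path_def path_image_def pathstart_def pathfinish_def)

lemma path_class_eq_iff:
  assumes "p \<in> loops_at S x"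
  shows "path_class S p = path_class S q \<longleftrightarrow> homotopic_paths S p q"
proof
  assume "path_class S p = path_class S q"
  moreover have "p \<in> path_class S p" using assms by (auto simp: path_class_def loops_at_def)
  ultimately have "p \<in> path_class S q" by simp
  then show "homotopic_paths S p q" by (simp add: path_class_def homotopic_paths_sym)
next
  assume "homotopic_paths S p q"
  then show "path_class S p = path_class S q"
    unfolding path_class_def by (blast intro: homotopic_paths_trans homotopic_paths_sym)
qed

lemma carrier_fundamental_group: "carrier (fundamental_group S x) = path_class S ` loops_at S x"
  by (auto simp: fundamental_group_def quotient_def path_class_def loops_at_def)

lemma one_fundamental_group: "\<one>\<^bsub>fundamental_group S x\<^esub> = path_class S (\<lambda>_. x)"
  by (simp add: fundamental_group_def path_class_def)

lemma mult_fundamental_group: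
  assumes "p \<in> loops_at S x" "q \<in> loops_at S x"
  shows "path_class S p \<otimes>\<^bsub>fundamental_group S x\<^esub> path_class S q = path_class S (p +++ q)"
proof -
  have "homotopic_paths S (p +++ q) r"
    if "homotopic_paths S p p'" "homotopic_paths S q q'" "homotopic_paths S (p' +++ q') r" for p' q' r
  proof -
    have "homotopic_paths S (p +++ q) (p' +++ q')"
      using that assms by (intro homotopic_paths_join) (auto dest: loops_atD)
    then show ?thesis using that(3) by (rule homotopic_paths_trans)
  qed
  moreover have "homotopic_paths S p p" "homotopic_paths S q q"
    using assms by (auto simp: loops_at_def)
  ultimately show ?thesis
    unfolding fundamental_group_def path_class_def by (auto simp del: homotopic_paths_refl)
qed

lemma group_fundamental_group:
  assumes "x \<in> S"
  shows "group (fundamental_group S x)"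
proof (rule groupI)
  note [simp] = carrier_fundamental_group one_fundamental_group mult_fundamental_group
    loops_at_closed const_in_loops_at[OF assms]
  let ?G = "fundamental_group S x"
  show "\<one>\<^bsub>?G\<^esub> \<in> carrier ?G" by simp
  show "a \<otimes>\<^bsub>?G\<^esub> b \<in> carrier ?G" if "a \<in> carrier ?G" "b \<in> carrier ?G" for a b
    using that by auto
  show "a \<otimes>\<^bsub>?G\<^esub> b \<otimes>\<^bsub>?G\<^esub> c = a \<otimes>\<^bsub>?G\<^esub> (b \<otimes>\<^bsub>?G\<^esub> c)"
    if abc: "a \<in> carrier ?G" "b \<in> carrier ?G" "c \<in> carrier ?G" for a b c
  proof -
    from abc obtain p q r where pqr: "p \<in> loops_at S x" "q \<in> loops_at S x" "r \<in> loops_at S x"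
      "a = path_class S p" "b = path_class S q" "c = path_class S r" by auto
    then have "homotopic_paths S (p +++ (q +++ r)) ((p +++ q) +++ r)"
      by (intro homotopic_paths_assoc) (auto dest: loops_atD)
    with pqr show ?thesis
      using path_class_eq_iff[of "p +++ (q +++ r)" S x "(p +++ q) +++ r"] by simp
  qed
  show "\<one>\<^bsub>?G\<^esub> \<otimes>\<^bsub>?G\<^esub> a = a" if "a \<in> carrier ?G" for a
  proof -
    from that obtain p where p: "p \<in> loops_at S x" "a = path_class S p" by auto
    then have "homotopic_paths S ((\<lambda>_. x) +++ p) p"
      using homotopic_paths_const_left[of p S] by (auto dest: loops_atD)
    with p show ?thesis
      using path_class_eq_iff[of "(\<lambda>_. x) +++ p" S x p] by simp
  qed
  show "\<exists>b\<in>carrier ?G. b \<otimes>\<^bsub>?G\<^esub> a = \<one>\<^bsub>?G\<^esub>" if "a \<in> carrier ?G" for a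
  proof -
    from that obtain p where p: "p \<in> loops_at S x" "a = path_class S p" by auto
    then have "homotopic_paths S (reversepath p +++ p) (\<lambda>_. x)"
      using homotopic_paths_inv_left[of p S] by (auto dest: loops_atD)
    with p show ?thesis
      using path_class_eq_iff[of "reversepath p +++ p" S x "\<lambda>_. x"]
      by (intro bexI[of _ "path_class S (reversepath p)"]) auto
  qed
qed

text \<open>The value at a class is read off from a chosen member, which invariance makes harmless.
  Both the change of base point and the winding numbers are defined on classes in this way.\<close>

lemma path_class_function:
  assumes "\<And>p q. p \<in> loops_at S x \<Longrightarrow> homotopic_paths S p q \<Longrightarrow> f p = f q"
  shows "\<exists>\<phi>. \<forall>p\<in>loops_at S x. \<phi> (path_class S p) = f p"
proof (rule exI[of _ "\<lambda>A. f (SOME q. q \<in> A)"], rule ballI)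
  fix p assume p: "p \<in> loops_at S x"
  have "(SOME q. q \<in> path_class S p) \<in> path_class S p"
    by (rule someI[of "\<lambda>q. q \<in> path_class S p" p]) (use p in \<open>auto simp: path_class_def loops_at_def\<close>)
  then show "f (SOME q. q \<in> path_class S p) = f p"
    using assms[OF p] by (simp add: path_class_def)
qed

text \<open>This is the inclusion of \<open>F\<close> in \<open>N\<close> followed by the change of
  base point along \<open>g\<close>. It is injective because the conjugation cancels in
  \<open>N\<close>, after which incompressibility moves the homotopy into \<open>F\<close>.\<close>

lemma conjugation_hom:
  assumes g: "path g" "path_image g \<subseteq> N" "pathstart g = x" "pathfinish g = b"
    and F: "F \<subseteq> N" "incompressible_in N F"
  obtains \<phi> where "\<phi> \<in> hom (fundamental_group F b) (fundamental_group N x)"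
    "inj_on \<phi> (carrier (fundamental_group F b))"
    "\<And>m. m \<in> loops_at F b \<Longrightarrow> \<phi> (path_class F m) = path_class N (g +++ (m +++ reversepath g))"
proof -
  let ?c = "\<lambda>m. g +++ (m +++ reversepath g)"
  have loopN: "?c m \<in> loops_at N x" if "m \<in> loops_at F b" for m
    using that g F by (auto simp: loops_at_def path_image_join)
  have conj: "path_class N (?c p) = path_class N (?c q)"
    if pq: "p \<in> loops_at F b" "homotopic_paths F p q" for p q
  proof -
    have "homotopic_paths N p q" using pq F homotopic_paths_subset by blast
    then have "homotopic_paths N (?c p) (?c q)"
      using g pq by (intro homotopic_paths_join) (auto dest: loops_atD homotopic_paths_imp_pathfinish)
    then show ?thesis
      using path_class_eq_iff[OF loopN[OF pq(1)]] by blast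
  qed
  have "\<exists>\<phi>. \<forall>m\<in>loops_at F b. \<phi> (path_class F m) = path_class N (?c m)"
    by (rule path_class_function) (rule conj)
  then obtain \<phi> where "\<forall>m\<in>loops_at F b. \<phi> (path_class F m) = path_class N (?c m)" ..
  then have \<phi>: "\<phi> (path_class F m) = path_class N (?c m)" if "m \<in> loops_at F b" for m
    using that by (rule bspec)
  show ?thesis
  proof (rule that[OF _ _ \<phi>])
    show "\<phi> \<in> hom (fundamental_group F b) (fundamental_group N x)"
    proof (rule homI)
      fix A B assume "A \<in> carrier (fundamental_group F b)" "B \<in> carrier (fundamental_group F b)"
      then obtain m n where m: "m \<in> loops_at F b" "A = path_class F m"
        and n: "n \<in> loops_at F b" "B = path_class F n"
        by (auto simp: carrier_fundamental_group)
      show "\<phi> A \<in> carrier (fundamental_group N x)"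
        using m by (auto simp: \<phi> carrier_fundamental_group loopN)
      have "homotopic_paths N (?c m +++ ?c n) (?c (m +++ n))"
        using g m n F by (intro homotopic_paths_conjugate_join) (auto simp: loops_at_def)
      then show "\<phi> (A \<otimes>\<^bsub>fundamental_group F b\<^esub> B) = \<phi> A \<otimes>\<^bsub>fundamental_group N x\<^esub> \<phi> B"
        using m n path_class_eq_iff[of "?c m +++ ?c n" N x "?c (m +++ n)"]
        by (simp add: mult_fundamental_group loops_at_closed \<phi> loopN)
    qed
    show "inj_on \<phi> (carrier (fundamental_group F b))"
    proof (rule inj_onI)
      fix A B assume "A \<in> carrier (fundamental_group F b)" "B \<in> carrier (fundamental_group F b)"
        and eq: "\<phi> A = \<phi> B"
      then obtain m n where m: "m \<in> loops_at F b" "A = path_class F m"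
        and n: "n \<in> loops_at F b" "B = path_class F n"
        by (auto simp: carrier_fundamental_group)
      then have "homotopic_paths N (?c m) (?c n)"
        using eq path_class_eq_iff[OF loopN[OF m(1)]] by (simp add: \<phi>)
      then have "homotopic_paths N m n"
        using g m n F by (intro homotopic_paths_conjugate_cancel[of g N m n]) (auto simp: loops_at_def)
      then have "homotopic_paths F m n"
        using F m n unfolding incompressible_in_def loops_at_def by auto
      then show "A = B" using path_class_eq_iff[OF m(1)] m n by simp
    qed
  qed
qed

section \<open>The torus\<close>

abbreviation torus :: "(complex \<times> complex) set" where
  "torus \<equiv> sphere 0 1 \<times> sphere 0 1"

text \<open>Any homeomorphism is corrected by dividing each circle coordinate by its value at
  \<open>b\<close>. With \<open>b\<close> at the unit of the group, products of loops at
  \<open>b\<close> and the coordinate circles pass through \<open>b\<close>.\<close>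

lemma torus_chart:
  assumes "F homeomorphic torus" "b \<in> F"
  obtains f k where "homeomorphism F torus f k" "f b = (1, 1)"
proof -
  obtain f k where fk: "homeomorphism F torus f k"
    using assms(1) by (auto simp: homeomorphic_def)
  obtain u v where uv: "f b = (u, v)" by fastforce
  moreover have "f b \<in> torus"
    using fk assms(2) by (auto simp: homeomorphism_def)
  ultimately have norm: "norm u = 1" "norm v = 1" by auto
  then have nz: "u \<noteq> 0" "v \<noteq> 0" by auto
  have "homeomorphism torus torus (\<lambda>z. (fst z / u, snd z / v)) (\<lambda>z. (fst z * u, snd z * v))"
    using norm nz by (intro homeomorphismI) (auto intro!: continuous_intros simp: norm_divide norm_mult)
  from homeomorphism_compose[OF fk this]
  have "homeomorphism F torus ((\<lambda>z. (fst z / u, snd z / v)) \<circ> f) (k \<circ> (\<lambda>z. (fst z * u, snd z * v)))" .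
  then show ?thesis
    using that uv nz by fastforce
qed

text \<open>
  With \<open>f b\<close> as the unit of the group \<open>S\<^sup>1 \<times> S\<^sup>1\<close>, the products \<open>p s * q t\<close> define a map of the unit
  square, and the two concatenations are its restrictions to the two halves of the boundary.
\<close>

lemma torus_loops_commute:
  assumes "F homeomorphic torus" "b \<in> F" and p: "p \<in> loops_at F b" and q: "q \<in> loops_at F b"
  shows "homotopic_paths F (p +++ q) (q +++ p)"
proof -
  obtain f k where fk: "homeomorphism F torus f k" and b: "f b = (1, 1)"
    using torus_chart[OF assms(1,2)] .
  note p = loops_atD[OF p] and q = loops_atD[OF q]
  have pF: "p t \<in> F" "q t \<in> F" if "t \<in> {0..1}" for t
    using that p q by (auto simp: path_image_def)
  have T: "f y \<in> torus" "k (f y) = y" if "y \<in> F" for y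
    using that fk by (auto simp: homeomorphism_def)
  have cont: "continuous_on F f" "continuous_on torus k" "k ` torus = F"
    using fk by (auto simp: homeomorphism_def)
  define \<mu> where "\<mu> z = (fst (f (p (fst z))) * fst (f (q (snd z))), snd (f (p (fst z))) * snd (f (q (snd z))))" for z
  let ?Q = "{0..1::real} \<times> {0..1::real}"
  have \<mu>: "\<mu> z \<in> torus" if "z \<in> ?Q" for z
    using that T(1)[OF pF(1)[of "fst z"]] T(1)[OF pF(2)[of "snd z"]]
    by (auto simp: \<mu>_def mem_Times_iff norm_mult)
  then have \<mu>_image: "\<mu> ` ?Q \<subseteq> torus" by blast
  have "continuous_on ?Q (\<lambda>z. f (p (fst z)))" "continuous_on ?Q (\<lambda>z. f (q (snd z)))"
    using p(1) q(1) pF unfolding path_def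
    by (auto intro!: continuous_on_compose2[OF cont(1)] continuous_on_compose2[of "{0..1}" p]
        continuous_on_compose2[of "{0..1}" q] continuous_intros)
  then have "continuous_on ?Q \<mu>"
    unfolding \<mu>_def by (intro continuous_intros)
  then have c: "continuous_on ?Q (k \<circ> \<mu>)"
    using \<mu>_image by (intro continuous_on_compose continuous_on_subset[OF cont(2)])
  have im: "(k \<circ> \<mu>) ` ?Q \<subseteq> F"
    using \<mu> cont(3) by fastforce
  let ?\<sigma> = "linepath (0, 0) (1, 0) +++ linepath (1, 0) (1, 1) :: real \<Rightarrow> real \<times> real"
  let ?\<tau> = "linepath (0, 0) (0, 1) +++ linepath (0, 1) (1, 1) :: real \<Rightarrow> real \<times> real"
  have convex: "convex ?Q"
    by (intro convex_Times) auto
  have sub: "path_image ?\<sigma> \<subseteq> ?Q" "path_image ?\<tau> \<subseteq> ?Q"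
    using convex by (intro subset_path_image_join; simp add: closed_segment_subset)+
  have hom: "homotopic_paths F ((k \<circ> \<mu>) \<circ> ?\<sigma>) ((k \<circ> \<mu>) \<circ> ?\<tau>)"
    using sub by (intro homotopic_paths_convex_image[OF convex c im]) auto
  have ends: "p 0 = b" "p 1 = b" "q 0 = b" "q 1 = b"
    using p q by (auto simp: pathstart_def pathfinish_def)
  have "homotopic_paths F (p +++ q) ((k \<circ> \<mu>) \<circ> ?\<sigma>)"
  proof (rule homotopic_paths_eq)
    fix t :: real assume "t \<in> {0..1}"
    then show "(p +++ q) t = ((k \<circ> \<mu>) \<circ> ?\<sigma>) t"
      using ends b T(2)[OF pF(1)] T(2)[OF pF(2)] by (auto simp: joinpaths_def linepath_def \<mu>_def)
  qed (use p q in \<open>auto simp: subset_path_image_join\<close>)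
  also note hom
  also have "homotopic_paths F ((k \<circ> \<mu>) \<circ> ?\<tau>) (q +++ p)"
  proof (rule homotopic_paths_sym, rule homotopic_paths_eq)
    fix t :: real assume "t \<in> {0..1}"
    then show "(q +++ p) t = ((k \<circ> \<mu>) \<circ> ?\<tau>) t"
      using ends b T(2)[OF pF(1)] T(2)[OF pF(2)] by (auto simp: joinpaths_def linepath_def \<mu>_def)
  qed (use p q in \<open>auto simp: subset_path_image_join\<close>)
  finally show ?thesis .
qed

section \<open>Winding numbers, and why the group of the torus is not cyclic\<close>

text \<open>The winding number around 0 is invariant under homotopies avoiding 0 and additive under
  concatenation, so each nowhere vanishing \<open>f\<close> yields a homomorphism to the complex
  numbers. It serves for the two coordinates of the torus.\<close>

lemma winding_number_hom:
  assumes b: "b \<in> F" and f: "continuous_on F f" "f ` F \<subseteq> - {0}"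
  obtains W where "\<And>p. p \<in> loops_at F b \<Longrightarrow> W (path_class F p) = winding_number (f \<circ> p) 0"
    "\<And>A B. A \<in> carrier (fundamental_group F b) \<Longrightarrow> B \<in> carrier (fundamental_group F b) \<Longrightarrow>
      W (A \<otimes>\<^bsub>fundamental_group F b\<^esub> B) = W A + W B"
proof -
  have inv: "winding_number (f \<circ> p) 0 = winding_number (f \<circ> q) 0" if "homotopic_paths F p q" for p q
    using f that by (intro winding_number_homotopic_paths homotopic_paths_continuous_image[of F p q]) auto
  have "\<exists>W. \<forall>p\<in>loops_at F b. W (path_class F p) = winding_number (f \<circ> p) 0"
    by (rule path_class_function) (rule inv)
  then obtain W where "\<forall>p\<in>loops_at F b. W (path_class F p) = winding_number (f \<circ> p) 0" ..
  then have W: "W (path_class F p) = winding_number (f \<circ> p) 0" if "p \<in> loops_at F b" for p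
    using that by (rule bspec)
  show ?thesis
  proof (rule that[of W])
    fix A B assume "A \<in> carrier (fundamental_group F b)" "B \<in> carrier (fundamental_group F b)"
    then obtain m n where mn: "m \<in> loops_at F b" "A = path_class F m"
      "n \<in> loops_at F b" "B = path_class F n"
      by (auto simp: carrier_fundamental_group)
    note m = loops_atD[OF mn(1)] and n = loops_atD[OF mn(3)]
    have "winding_number ((f \<circ> m) +++ (f \<circ> n)) 0 = winding_number (f \<circ> m) 0 + winding_number (f \<circ> n) 0"
    proof (rule winding_number_join)
      show "path (f \<circ> m)" "path (f \<circ> n)"
        using m n f by (auto intro!: path_continuous_image intro: continuous_on_subset)
      show "0 \<notin> path_image (f \<circ> m)" "0 \<notin> path_image (f \<circ> n)"
        using m n f by (auto simp: path_image_compose)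
      show "pathfinish (f \<circ> m) = pathstart (f \<circ> n)"
        using m n by (simp add: pathfinish_compose pathstart_compose)
    qed
    then show "W (A \<otimes>\<^bsub>fundamental_group F b\<^esub> B) = W A + W B"
      using mn by (simp add: mult_fundamental_group loops_at_closed W path_compose_join)
  qed (rule W)
qed

text \<open>The factor \<open>k\<close> is the exponent of \<open>y\<close> as a power of
  \<open>c\<close>, hence the same for both functions.\<close>

lemma additive_on_cyclic:
  fixes P (structure) and W W' :: "'g \<Rightarrow> complex"
  assumes "group P" "c \<in> carrier P" "y \<in> generate P {c}"
    and "\<And>A B. A \<in> carrier P \<Longrightarrow> B \<in> carrier P \<Longrightarrow> W (A \<otimes> B) = W A + W B"
    and "\<And>A B. A \<in> carrier P \<Longrightarrow> B \<in> carrier P \<Longrightarrow> W' (A \<otimes> B) = W' A + W' B"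
  shows "\<exists>k. W y = k * W c \<and> W' y = k * W' c"
proof -
  interpret group P by fact
  have sub: "h \<in> carrier P" if "h \<in> generate P {c}" for h
    using that assms(2) by (intro generate_in_carrier[of "{c}"]) auto
  have V_one: "V \<one> = 0" and V_inv: "V (inv c) = - V c"
    if "\<And>A B. A \<in> carrier P \<Longrightarrow> B \<in> carrier P \<Longrightarrow> V (A \<otimes> B) = V A + V B" for V :: "'g \<Rightarrow> complex"
  proof -
    show one: "V \<one> = 0" using that[of \<one> \<one>] by simp
    have "V (inv c) + V c = V \<one>" using that[of "inv c" c] assms(2) by simp
    then show "V (inv c) = - V c" using one by (simp add: eq_neg_iff_add_eq_0)
  qed
  show ?thesis
    using assms(3)
  proof induction
    case one
    show ?case using V_one[OF assms(4)] V_one[OF assms(5)] by (intro exI[of _ 0]) simp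
  next
    case (incl h)
    then show ?case by (intro exI[of _ 1]) simp
  next
    case (inv h)
    then show ?case using V_inv[OF assms(4)] V_inv[OF assms(5)] by (intro exI[of _ "-1"]) simp
  next
    case (eng h1 h2)
    then obtain k l where "W h1 = k * W c" "W' h1 = k * W' c" "W h2 = l * W c" "W' h2 = l * W' c"
      by blast
    then show ?case
      using eng assms(4,5)[OF sub sub] by (intro exI[of _ "k + l"]) (simp add: distrib_right)
  qed
qed

text \<open>In a cyclic group the pairs of winding numbers would all be multiples of the pair of the
  generator, but (1, 0) and (0, 1) both occur.\<close>

lemma torus_group_not_cyclic:
  assumes "F homeomorphic torus" "b \<in> F" and c: "c \<in> carrier (fundamental_group F b)"
  shows "carrier (fundamental_group F b) - generate (fundamental_group F b) {c} \<noteq> {}"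
proof
  assume "carrier (fundamental_group F b) - generate (fundamental_group F b) {c} = {}"
  then have gen: "A \<in> generate (fundamental_group F b) {c}" if "A \<in> carrier (fundamental_group F b)" for A
    using that by blast
  obtain f k where fk: "homeomorphism F torus f k" and b: "f b = (1, 1)"
    using torus_chart[OF assms(1,2)] .
  have cont: "continuous_on F f" "continuous_on torus k" "k ` torus = F" "f ` F = torus"
    using fk by (auto simp: homeomorphism_def)
  have kb: "k (1, 1) = b" and fk': "\<And>z. z \<in> torus \<Longrightarrow> f (k z) = z"
    using fk b assms(2) by (auto simp: homeomorphism_def)
  have c1: "continuous_on F (fst \<circ> f)" "continuous_on F (snd \<circ> f)"
    using cont(1) by (auto intro!: continuous_intros)
  have im: "(fst \<circ> f) ` F \<subseteq> - {0}" "(snd \<circ> f) ` F \<subseteq> - {0}"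
    unfolding image_comp[symmetric] cont(4) by auto
  obtain W where W: "\<And>p. p \<in> loops_at F b \<Longrightarrow> W (path_class F p) = winding_number ((fst \<circ> f) \<circ> p) 0"
    "\<And>A B. A \<in> carrier (fundamental_group F b) \<Longrightarrow> B \<in> carrier (fundamental_group F b) \<Longrightarrow>
      W (A \<otimes>\<^bsub>fundamental_group F b\<^esub> B) = W A + W B"
    using winding_number_hom[OF assms(2) c1(1) im(1)] by metis
  obtain W' where W': "\<And>p. p \<in> loops_at F b \<Longrightarrow> W' (path_class F p) = winding_number ((snd \<circ> f) \<circ> p) 0"
    "\<And>A B. A \<in> carrier (fundamental_group F b) \<Longrightarrow> B \<in> carrier (fundamental_group F b) \<Longrightarrow>
      W' (A \<otimes>\<^bsub>fundamental_group F b\<^esub> B) = W' A + W' B"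
    using winding_number_hom[OF assms(2) c1(2) im(2)] by metis
  have ex: "\<exists>k. W A = k * W c \<and> W' A = k * W' c" if "A \<in> carrier (fundamental_group F b)" for A
    using additive_on_cyclic[OF group_fundamental_group[OF assms(2)] c gen[OF that] W(2) W'(2)] .
  have circle: "circlepath 0 1 t \<in> sphere 0 1" for t
    by (simp add: circlepath)
  have circle': "continuous_on S (circlepath 0 1)" for S
    unfolding circlepath by (intro continuous_intros)
  have circle01: "circlepath 0 1 0 = 1" "circlepath 0 1 1 = 1"
    by (simp_all add: circlepath)
  \<comment> \<open>\<open>circlepath 0 1\<close> starts and ends at 1 and \<open>k\<close> sends
    (1, 1) to \<open>b\<close>, so the two coordinate circles are loops at \<open>b\<close>.\<close>
  let ?m = "\<lambda>t. k (circlepath 0 1 t, 1)" and ?l = "\<lambda>t. k (1, circlepath 0 1 t)"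
  have "?m \<in> loops_at F b" "?l \<in> loops_at F b"
    using circle circle01 kb cont(3) unfolding loops_at_def path_def path_image_def pathstart_def pathfinish_def
    by (auto intro!: continuous_on_compose2[OF cont(2)] continuous_intros circle')
  moreover have "(fst \<circ> f) \<circ> ?m = circlepath 0 1" "(snd \<circ> f) \<circ> ?m = linepath 1 1"
    "(fst \<circ> f) \<circ> ?l = linepath 1 1" "(snd \<circ> f) \<circ> ?l = circlepath 0 1"
    using circle by (auto simp: fk' fun_eq_iff)
  ultimately have "\<exists>k. 1 = k * W c \<and> 0 = k * W' c" "\<exists>k. 0 = k * W c \<and> 1 = k * W' c"
    using ex[of "path_class F ?m"] ex[of "path_class F ?l"] W(1)[of ?m] W(1)[of ?l] W'(1)[of ?m] W'(1)[of ?l]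
    by (auto simp: carrier_fundamental_group winding_number_circlepath_centre)
  then show False by auto
qed

section \<open>Slopes\<close>

text \<open>A chart makes \<open>N\<close> locally path connected: a small ball intersected with the
  half-space is convex, also at boundary points. This supplies the path from the base point
  \<open>x\<close> to a curve on the boundary.\<close>

lemma three_manifold_path_component:
  assumes "three_manifold N" "connected N" "a \<in> N" "b \<in> N"
  shows "path_component N a b"
proof (rule connected_equivalence_relation[OF assms(2-4)])
  show "path_component N y x" if "path_component N x y" for x y
    using that by (rule path_component_sym)
  show "path_component N x z" if "path_component N x y" "path_component N y z" for x y z
    using that by (rule path_component_trans)
  fix a assume "a \<in> N"
  then obtain U V where U: "openin (top_of_set N) U" "a \<in> U"
    and V: "openin (top_of_set half_space) V" and "U homeomorphic V"
    using assms(1) unfolding three_manifold_def by blast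
  then obtain f k where fk: "homeomorphism U V f k" by (auto simp: homeomorphic_def)
  then have fa: "f a \<in> V" and fU: "f ` U = V" "k ` V = U" "continuous_on U f" "continuous_on V k"
    and kf: "\<And>u. u \<in> U \<Longrightarrow> k (f u) = u" and fk': "\<And>v. v \<in> V \<Longrightarrow> f (k v) = v"
    using U by (auto simp: homeomorphism_def)
  from V fa obtain e where e: "e > 0" "ball (f a) e \<inter> half_space \<subseteq> V"
    unfolding openin_contains_ball by blast
  have Vh: "V \<subseteq> half_space" using V openin_imp_subset by blast
  let ?D = "ball (f a) e \<inter> half_space"
  define T where "T = U \<inter> f -` ball (f a) e"
  \<comment> \<open>As a preimage \<open>T\<close> is open, as an image of a convex set it is path
    connected; both descriptions are needed.\<close>
  have T: "T = k ` ?D"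
  proof
    show "T \<subseteq> k ` ?D"
    proof
      fix u assume "u \<in> T"
      then have "u \<in> U" "f u \<in> ball (f a) e" by (auto simp: T_def)
      moreover from this have "f u \<in> half_space" using fU(1) Vh by auto
      ultimately show "u \<in> k ` ?D" using kf by (intro image_eqI[of _ _ "f u"]) auto
    qed
    show "k ` ?D \<subseteq> T"
    proof
      fix u assume "u \<in> k ` ?D"
      then obtain v where v: "v \<in> ?D" "u = k v" by blast
      then have "v \<in> V" using e by blast
      with v show "u \<in> T" using fU(2) fk' by (auto simp: T_def)
    qed
  qed
  have "openin (top_of_set U) T"
    unfolding T_def using fU(3) by (intro continuous_openin_preimage_gen) auto
  then have T_open: "openin (top_of_set N) T"
    using U(1) openin_trans by blast
  have "convex half_space"
    by (simp add: half_space_def convex_def)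
  then have "path_connected ?D"
    by (intro convex_imp_path_connected convex_Int) auto
  then have "path_connected T"
    unfolding T using e fU(4) by (intro path_connected_continuous_image) (auto intro: continuous_on_subset)
  moreover have "a \<in> T" using U(2) e(1) by (simp add: T_def)
  moreover have "T \<subseteq> N" using T_open openin_imp_subset by blast
  ultimately have "\<forall>x\<in>T. path_component N a x"
    by (meson path_component_of_subset path_connected_component)
  with T_open \<open>a \<in> T\<close> show "\<exists>T. openin (top_of_set N) T \<and> a \<in> T \<and> (\<forall>x\<in>T. path_component N a x)"
    by blast
qed

lemma slope_curve:
  assumes "\<alpha> \<in> slopes N"
  shows "\<alpha> \<noteq> {}" "\<alpha> \<subseteq> essential_curves (manifold_boundary N)"
proof -
  let ?F = "manifold_boundary N"
  from assms obtain c where c: "c \<in> essential_curves ?F"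
    and \<alpha>: "\<alpha> = {d. c \<in> essential_curves ?F \<and> d \<in> essential_curves ?F \<and>
           (isotopic_curves ?F c d \<or> isotopic_curves ?F (reversepath c) d)}"
    unfolding slopes_def Let_def quotient_def by auto
  have "isotopic_curves ?F c c"
    using c unfolding isotopic_curves_def essential_curves_def
    by (auto simp: homotopic_with_refl simple_path_def path_def path_image_def)
  with c \<alpha> show "\<alpha> \<noteq> {}" by auto
  show "\<alpha> \<subseteq> essential_curves ?F" using \<alpha> by auto
qed

text \<open>The element picked by \<open>SOME\<close> is under control only once some representative
  exists; it is then freely homotopic to a curve of the slope, and the track of the base point is
  the conjugating path.\<close>

lemma slope_represented_by_conjugate:
  assumes N: "three_manifold N" "connected N" "x \<in> N" and \<alpha>: "\<alpha> \<in> slopes N"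
  obtains g c where "path g" "path_image g \<subseteq> N" "pathstart g = x" "pathfinish g = pathstart c"
    "c \<in> loops_at (manifold_boundary N) (pathstart c)"
    "(SOME \<gamma>. represents_slope N x \<gamma> \<alpha>) = path_class N (g +++ (c +++ reversepath g))"
proof -
  let ?F = "manifold_boundary N"
  have FN: "?F \<subseteq> N" by (auto simp: manifold_boundary_def)
  have loop: "d \<in> loops_at ?F (pathstart d)" if "d \<in> \<alpha>" for d
    using that slope_curve(2)[OF \<alpha>]
    by (auto simp: essential_curves_def loops_at_def simple_path_def)
  obtain d where d: "d \<in> \<alpha>" using slope_curve(1)[OF \<alpha>] by blast
  note dl = loops_atD[OF loop[OF d]]
  have "pathstart d \<in> N" using dl FN by (metis pathstart_in_path_image subsetD)
  \<comment> \<open>A curve of the slope, joined to \<open>x\<close> by a path and back, is the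
    representative that justifies \<open>SOME\<close>.\<close>
  then have "path_component N x (pathstart d)"
    using N by (intro three_manifold_path_component)
  then obtain g where g: "path g" "path_image g \<subseteq> N" "pathstart g = x" "pathfinish g = pathstart d"
    by (auto simp: path_component_def)
  let ?p = "g +++ (d +++ reversepath g)"
  have p: "?p \<in> loops_at N x"
    using g dl FN by (auto simp: loops_at_def path_image_join)
  have "homotopic_loops N ?p d"
    using g dl FN by (intro homotopic_loops_conjugate_top) auto
  moreover have "?p \<in> path_class N ?p"
    using p by (auto simp: path_class_def loops_at_def)
  ultimately have "represents_slope N x (path_class N ?p) \<alpha>"
    using p dl d unfolding represents_slope_def peripheral_def carrier_fundamental_group by blast
  then have "represents_slope N x (SOME \<gamma>. represents_slope N x \<gamma> \<alpha>) \<alpha>"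
    by (rule someI)
  \<comment> \<open>The picked element comes with its own curve \<open>c\<close> and path
    \<open>h\<close>, in general different from \<open>d\<close> and \<open>g\<close>.\<close>
  then obtain q p c where q: "q \<in> loops_at N x" "(SOME \<gamma>. represents_slope N x \<gamma> \<alpha>) = path_class N q"
    and p: "p \<in> path_class N q" and c: "c \<in> \<alpha>" "homotopic_loops N p c"
    unfolding represents_slope_def peripheral_def carrier_fundamental_group by auto
  have qp: "homotopic_paths N q p" using p by (simp add: path_class_def)
  obtain h where h: "path h" "path_image h \<subseteq> N" "pathstart h = pathstart p" "pathfinish h = pathstart c"
    "homotopic_paths N p (h +++ (c +++ reversepath h))"
    using homotopic_loops_imp_conjugate[OF c(2)] .
  have "homotopic_paths N q (h +++ (c +++ reversepath h))"
    using qp h(5) by (rule homotopic_paths_trans)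
  then have "path_class N q = path_class N (h +++ (c +++ reversepath h))"
    using path_class_eq_iff[OF q(1)] by blast
  moreover have "pathstart h = x"
    using h(3) homotopic_paths_imp_pathstart[OF qp] loops_atD[OF q(1)] by simp
  ultimately show ?thesis
    using that[of h c] h loop[OF c(1)] q(2) by simp
qed

theorem proposition1p4:
  fixes N :: "'a::topological_space set"
  assumes "knot_manifold N"
    and "x \<in> N"
    and "norm_curve_component N x X"
    and "\<alpha> \<in> slopes N"
  shows "slope_rank N x X \<alpha> \<ge> 2"
proof -
  define F where "F = manifold_boundary N"
  define G where "G = fundamental_group N x"
  have N: "three_manifold N" "connected N" "F homeomorphic torus" "incompressible_in N F"
    using assms(1) by (auto simp: knot_manifold_def F_def)
  have FN: "F \<subseteq> N" by (auto simp: F_def manifold_boundary_def)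
  have X: "irreducible_algebraic_subset G X"
    and nonconst: "\<And>\<delta>. peripheral N x \<delta> \<Longrightarrow> \<delta> \<noteq> \<one>\<^bsub>G\<^esub> \<Longrightarrow> trace_function X \<delta> \<notin> constant_functions X"
    using assms(3) by (auto simp: norm_curve_component_def algebraic_component_def G_def)
  obtain g c where g: "path g" "path_image g \<subseteq> N" "pathstart g = x" "pathfinish g = pathstart c"
    and c: "c \<in> loops_at F (pathstart c)"
    and \<gamma>: "(SOME \<gamma>. represents_slope N x \<gamma> \<alpha>) = path_class N (g +++ (c +++ reversepath g))"
    using slope_represented_by_conjugate[OF N(1,2) assms(2,4)] unfolding F_def by metis
  define b where "b = pathstart c"
  define P where "P = fundamental_group F b"
  note c = c[folded b_def] and g = g[folded b_def]
  have b: "b \<in> F"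
    using loops_atD[OF c] by (metis pathstart_in_path_image subsetD)
  obtain \<phi> where hom: "\<phi> \<in> hom P G" and inj: "inj_on \<phi> (carrier P)"
    and \<phi>: "\<And>m. m \<in> loops_at F b \<Longrightarrow> \<phi> (path_class F m) = path_class N (g +++ (m +++ reversepath g))"
    using conjugation_hom[OF g FN N(4)] unfolding P_def G_def by metis
  interpret P: group P unfolding P_def by (rule group_fundamental_group[OF b])
  interpret G: group G unfolding G_def by (rule group_fundamental_group[OF assms(2)])
  interpret group_hom P G \<phi> by unfold_locales (rule hom)
  \<comment> \<open>By the choice of \<open>g\<close> and \<open>c\<close>, \<open>\<phi> a\<close>
    is the very element that \<open>slope_function\<close> uses.\<close>
  define a where "a = path_class F c"
  have a: "a \<in> carrier P" using c by (simp add: a_def P_def carrier_fundamental_group)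
  define S where "S = carrier P - generate P {a}"
  have S_nonempty: "S \<noteq> {}"
    using torus_group_not_cyclic[OF N(3) b] a unfolding S_def P_def by blast
  have comm: "A \<otimes>\<^bsub>P\<^esub> B = B \<otimes>\<^bsub>P\<^esub> A" if AB: "A \<in> carrier P" "B \<in> carrier P" for A B
  proof -
    from AB obtain m n where mn: "m \<in> loops_at F b" "A = path_class F m"
      "n \<in> loops_at F b" "B = path_class F n"
      by (auto simp: P_def carrier_fundamental_group)
    have "homotopic_paths F (m +++ n) (n +++ m)"
      using torus_loops_commute[OF N(3) b mn(1,3)] .
    with mn show ?thesis
      using path_class_eq_iff[of "m +++ n" F b "n +++ m"]
      by (simp add: P_def mult_fundamental_group loops_at_closed)
  qed
  have peripheral: "peripheral N x (\<phi> A)" if A: "A \<in> carrier P" for A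
  proof -
    from A obtain m where m: "m \<in> loops_at F b" "A = path_class F m"
      by (auto simp: P_def carrier_fundamental_group)
    let ?p = "g +++ (m +++ reversepath g)"
    have "homotopic_loops N ?p m"
      using g loops_atD[OF m(1)] FN by (intro homotopic_loops_conjugate_top) auto
    moreover have "\<phi> A \<in> carrier (fundamental_group N x)"
      using A hom_closed by (simp add: G_def)
    moreover have "?p \<in> path_class N ?p"
      using g loops_atD[OF m(1)] FN by (auto simp: path_class_def path_image_join)
    ultimately show ?thesis
      using m loops_atD[OF m(1)] unfolding peripheral_def F_def \<phi>[OF m(1), folded m(2)] by blast
  qed
  \<comment> \<open>The inverse of \<open>B\<close> would bring a product in the cyclic subgroup
    back to \<open>A\<close>, so \<open>A\<close> would lie there too. It is applied with
    \<open>a\<close> and its inverse as \<open>B\<close>.\<close>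
  have closed: "A \<otimes>\<^bsub>P\<^esub> B \<in> S" if A: "A \<in> S" and B: "B \<in> carrier P" "B \<in> generate P {a}"
    "inv\<^bsub>P\<^esub> B \<in> generate P {a}" for A B
  proof -
    have "A = (A \<otimes>\<^bsub>P\<^esub> B) \<otimes>\<^bsub>P\<^esub> inv\<^bsub>P\<^esub> B"
      using A B by (simp add: S_def P.m_assoc)
    then have "A \<otimes>\<^bsub>P\<^esub> B \<notin> generate P {a}"
      using A B generate.eng[of "A \<otimes>\<^bsub>P\<^esub> B" P "{a}" "inv\<^bsub>P\<^esub> B"] by (auto simp: S_def)
    then show ?thesis using A B by (simp add: S_def)
  qed
  have gen: "a \<in> generate P {a}" "inv\<^bsub>P\<^esub> a \<in> generate P {a}"
    by (auto intro: generate.incl generate.inv)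
  have "\<exists>\<delta>\<in>\<phi> ` S. \<nexists>p. \<forall>\<xi>\<in>X. \<xi> \<delta> = poly p (\<xi> (\<phi> a))"
  proof (rule ccontr)
    assume "\<not> ?thesis"
    then have polynomial: "\<exists>p. \<forall>\<xi>\<in>X. \<xi> \<delta> = poly p (\<xi> (\<phi> a))" if "\<delta> \<in> \<phi> ` S" for \<delta>
      using that by blast
    show False
    proof (rule not_all_traces_polynomial[OF G.is_group X, of "\<phi> a" "\<phi> ` S"])
      show "\<phi> a \<in> carrier G" using a by simp
      show "\<phi> ` S \<subseteq> carrier G" by (auto simp: S_def)
      show "\<phi> ` S \<noteq> {}" using S_nonempty by simp
    next
      fix \<delta> assume "\<delta> \<in> \<phi> ` S"
      then obtain A where A: "A \<in> S" "\<delta> = \<phi> A" by blast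
      then have AP: "A \<in> carrier P" "A \<noteq> \<one>\<^bsub>P\<^esub>"
        using generate.one[of P "{a}"] by (auto simp: S_def)
      show "\<delta> \<otimes>\<^bsub>G\<^esub> \<phi> a = \<phi> a \<otimes>\<^bsub>G\<^esub> \<delta>"
        unfolding A hom_mult[OF AP(1) a, symmetric] hom_mult[OF a AP(1), symmetric] comm[OF AP(1) a] ..
      show "\<delta> \<otimes>\<^bsub>G\<^esub> \<phi> a \<in> \<phi> ` S"
        unfolding A hom_mult[OF AP(1) a, symmetric] using closed A a gen by blast
      show "\<delta> \<otimes>\<^bsub>G\<^esub> inv\<^bsub>G\<^esub> \<phi> a \<in> \<phi> ` S"
        unfolding A hom_inv[OF a, symmetric] hom_mult[OF AP(1) P.inv_closed[OF a], symmetric]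
        using closed[OF A(1), of "inv\<^bsub>P\<^esub> a"] a gen by simp
      \<comment> \<open>\<open>A\<close> is not the unit because the unit belongs to the cyclic
        subgroup. Injectivity carries this to \<open>N\<close>, where the norm curve condition
        speaks about non-trivial peripheral elements.\<close>
      have "\<phi> A \<noteq> \<one>\<^bsub>G\<^esub>"
        using inj_onD[OF inj, of A "\<one>\<^bsub>P\<^esub>"] AP by auto
      then show "trace_function X \<delta> \<notin> constant_functions X"
        unfolding A using nonconst peripheral AP by blast
      show "\<exists>p. \<forall>\<xi>\<in>X. \<xi> \<delta> = poly p (\<xi> (\<phi> a))"
        using polynomial \<open>\<delta> \<in> \<phi> ` S\<close> .
    qed
  qed
  then obtain \<delta> where \<delta>: "\<delta> \<in> \<phi> ` S" "\<nexists>p. \<forall>\<xi>\<in>X. \<xi> \<delta> = poly p (\<xi> (\<phi> a))" by blast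
  moreover from \<delta>(1) have "\<delta> \<in> carrier G" by (auto simp: S_def)
  moreover have "X \<noteq> {}" using X by (simp add: irreducible_algebraic_subset_def)
  moreover have "slope_function N x X \<alpha> = trace_function X (\<phi> a)"
    unfolding slope_function_def \<gamma> a_def \<phi>[OF c] ..
  ultimately show ?thesis
    unfolding slope_rank_def using module_rank_single_trace_ge_2[of X \<delta> G "\<phi> a"] by (simp add: G_def)
qed

end
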